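(* Let $q\in\mathbb N$, $q\ge 3$, let $\Gamma=\Gamma_q$ be the Hecke triangle group, and let $F\in \mathrm{POQF}(\Gamma_h)$ be a $\Gamma$-form. Then the reduction algorithm described in the context, applied to $F$, is well-defined and terminates, and it finds all reduced $\Gamma$-forms that are $\Gamma$-equivalent to $F$. More precisely, it first converts $F$ into a $\Gamma$-equivalent reduced $\Gamma$-form $F_m$ (the preperiod $F_0,\dots,F_m$) and then produces a cycle $F_{m+1},\dots,F_{m+p}=F_m$ of pairwise distinct reduced $\Gamma$-forms, all $\Gamma$-equivalent to $F$, such that $\{F_{m+1},\dots,F_{m+p}\}$ is the set of all reduced $\Gamma$-forms that are $\Gamma$-equivalent to $F$. Moreover, the algorithm determines the level of $F$ (its output $n$ is the level of $F$) and the hyperbolic element in $\Gamma$ associated to $F$ (its output $h_m a_p^n h_m^{-1}$ equals $\psi_2(F)$).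
   Context: Group: $G=\mathrm{PSL}_2(\mathbb R)$ acts on $\mathbb H\cup P^1(\mathbb R)$ ($\mathbb H$ the upper half plane, $P^1(\mathbb R)=\mathbb R\cup\{\infty\}$) by fractional linear transformations; $r<\infty$ for all $r\in\mathbb R$. $\lambda=2\cos(\pi/q)$. The Hecke triangle group $\Gamma=\Gamma_q\subset G$ is generated by $S=\begin{bmatrix}0&1\\-1&0\end{bmatrix}$ and $T=\begin{bmatrix}1&\lambda\\0&1\end{bmatrix}$. $G_h$ is the set of hyperbolic elements of $G$ (those with $|\mathrm{tr}|>2$), $\Gamma_h=\Gamma\cap G_h$. The level of $g\in\Gamma_h$ is the maximal $n\in\mathbb N$ such that $g=h^n$ for some $h\in\Gamma$. Forms: For real $A,B,C$ with $D=B^2-4AC>0$ write $f=[A,B,C]$ for the indefinite quadratic form $Ax^2+Bxy+Cy^2$. A projective oriented quadratic form is a class $[f,s]=\{(f,s),(-f,-s)\}$ with $f=[A,B,C]$ an indefinite quadratic form ($A,B,C$ real, $B^2-4AC>0$) and $s\in\{\pm1\}$, also written $[A,B,C,s]$; $\mathrm{POQF}$ is the set of these. Put $x_\pm(f)=\frac{-B\pm\sqrt D}{2A}$ if $A\neq0$; if $A=0$ then $x_+=-C/B,\ x_-=\infty$ for $B>0$, and $x_+=\infty,\ x_-=-C/B$ for $B<0$. The attracting zero $x_a([f,s])$ is $x_+(f)$ if $s=+1$ and $x_-(f)$ if $s=-1$; the repelling zero $x_r([f,s])$ is the other one. $\varphi_2(F)=(x_a(F),x_r(F))$. $G$ acts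 on $\mathrm{POQF}$ by $g.[f,s]=[g.f,s]$ with $(g.f)(x,y)=f(dx-by,-cx+ay)$ for $g=\begin{bmatrix}a&b\\c&d\end{bmatrix}$. The map $\psi_2\colon \mathrm{POQF}\to G_h$, $[A,B,C,s]\mapsto\begin{bmatrix}\frac{-B+s\sqrt{D+4}}2&-C\\ A&\frac{B+s\sqrt{D+4}}2\end{bmatrix}$, is a $G$-equivariant bijection ($G$ acting on $G_h$ by conjugation) with inverse $\begin{bmatrix}a&b\\c&d\end{bmatrix}\mapsto[c,d-a,-b,\mathrm{sgn}(a+d)]$. $\mathrm{POQF}(\Gamma_h)=\psi_2^{-1}(\Gamma_h)$ is the set of $\Gamma$-forms; the hyperbolic element associated to $F$ is $\psi_2(F)$ and the level of $F$ is the level of $\psi_2(F)$. Two $\Gamma$-forms are $\Gamma$-equivalent if they lie in the same $\Gamma$-orbit. $F$ is reduced if $x_a(F)>0>x_r(F)$. Elements $g_k$: $U=TS$ and $g_k=(U^kS)^{-1}$ for $k\in\mathbb Z$, so $g_k^{-1}=\frac1{\sin(\pi/q)}\begin{bmatrix}\sin(\frac kq\pi)&\sin(\frac{k+1}q\pi)\\\sin(\frac{k-1}q\pi)&\sin(\frac kq\pi)\end{bmatrix}$. The intervals $(g_k^{-1}.0,g_k^{-1}.\infty)$, $k=1,\dots,q-1$, are disjoint with union $(0,\infty)\setminus\{g_k^{-1}.\infty\mid k=1,\dots,q-1\}$; for $x$ in this union, $\mathrm{interval}(x)=k$ iff $x\in(g_k^{-1}.0,g_k^{-1}.\infty)$.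 Reduction algorithm. Input: $F\in\mathrm{POQF}(\Gamma_h)$. Initialization: $F_0:=F$, $(x_0,y_0):=\varphi_2(F_0)$, $h_0:=\mathrm{id}$, $j:=0$. Preperiod: if $x_0<0$, set $F_1:=S.F_0$, $(x_1,y_1):=(S.x_0,S.y_0)$, $h_1:=S$, $j:=1$. While $F_j$ is not reduced: $k:=\mathrm{interval}(x_j)$, $F_{j+1}:=g_k.F_j$, $(x_{j+1},y_{j+1}):=(g_k.x_j,g_k.y_j)$, $h_{j+1}:=h_jg_k^{-1}$, $j:=j+1$. Then $m:=j$. Period: $a_0:=\mathrm{id}$. Repeat: $k:=\mathrm{interval}(x_j)$, $F_{j+1}:=g_k.F_j$, $(x_{j+1},y_{j+1}):=(g_k.x_j,g_k.y_j)$, $j:=j+1$, $a_{j-m}:=a_{j-m-1}g_k^{-1}$; until $(x_j,y_j)=(x_m,y_m)$. Then $p:=j-m$. Level: $n:=1$; while $\psi_2^{-1}(h_ma_p^nh_m^{-1})\ne F$, set $n:=n+1$. Output: level $n$; preperiod $F_0,\dots,F_m$; period $F_{m+1},\dots,F_{m+p}$; associated hyperbolic element $h_ma_p^nh_m^{-1}$. *)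

theory Defs
  imports "HOL-Analysis.Determinants" "HOL-Library.Monad_Syntax"
begin

section \<open>The group PSL(2,R)\<close>

definition mat2 :: "real \<Rightarrow> real \<Rightarrow> real \<Rightarrow> real \<Rightarrow> real^2^2" where
  "mat2 a b c d = vector [vector [a, b], vector [c, d]]"

lemma mat2_nth [simp]:
  "mat2 a b c d $ 1 $ 1 = a" "mat2 a b c d $ 1 $ 2 = b"
  "mat2 a b c d $ 2 $ 1 = c" "mat2 a b c d $ 2 $ 2 = d"
  by (simp_all add: mat2_def vector_2)

lemma det_uminus_2: "det (- M) = det (M :: real^2^2)"
  by (simp add: det_2)

lemma matrix_mult_uminus_left: "(- M) ** N = - (M ** (N :: real^2^2))"
  by (simp add: matrix_matrix_mult_def vec_eq_iff sum_negf)

lemma matrix_mult_uminus_right: "M ** (- N) = - (M ** (N :: real^2^2))"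
  by (simp add: matrix_matrix_mult_def vec_eq_iff sum_negf)

quotient_type psl2r = "real^2^2" / partial: "\<lambda>M N. det M = 1 \<and> (N = M \<or> N = - M)"
proof (rule part_equivpI)
  show "\<exists>M::real^2^2. det M = 1 \<and> (M = M \<or> M = - M)"
    by (rule exI[of _ "mat 1"]) simp
qed (auto intro!: sympI transpI simp: det_uminus_2)

instantiation psl2r :: "{monoid_mult, inverse}"
begin

lift_definition one_psl2r :: psl2r is "mat 1"
  by simp

lift_definition times_psl2r :: "psl2r \<Rightarrow> psl2r \<Rightarrow> psl2r" is "(**)"
  by (auto simp: det_mul matrix_mult_uminus_left matrix_mult_uminus_right)

lift_definition inverse_psl2r :: "psl2r \<Rightarrow> psl2r" is
  "\<lambda>M. mat2 (M$2$2) (- M$1$2) (- M$2$1) (M$1$1)"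
  by (auto simp: det_2 vec_eq_iff forall_2 mult.commute)

definition divide_psl2r :: "psl2r \<Rightarrow> psl2r \<Rightarrow> psl2r" where
  "divide_psl2r g h = g * inverse h"

instance
  by standard (transfer; auto simp: det_mul matrix_mul_assoc)+

end

lemma psl2r_left_inverse: "inverse g * g = (1::psl2r)"
  by transfer (auto simp: det_2 vec_eq_iff forall_2 matrix_matrix_mult_def sum_2 mat_def
      algebra_simps)

text \<open>The trace is determined up to sign only.\<close>

lift_definition abs_trace :: "psl2r \<Rightarrow> real" is "\<lambda>M. \<bar>trace M\<bar>"
  by (auto simp: trace_def sum_negf)

definition hyperbolic :: "psl2r set" where
  "hyperbolic = {g. abs_trace g > 2}"

text \<open>The projective line, ordered with infinity as the greatest element.\<close>

datatype p1r = Fin real | Infty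

instantiation p1r :: linorder
begin

fun less_eq_p1r :: "p1r \<Rightarrow> p1r \<Rightarrow> bool" where
  "Fin x \<le> Fin y \<longleftrightarrow> x \<le> y"
| "Infty \<le> Fin y \<longleftrightarrow> False"
| "_ \<le> Infty \<longleftrightarrow> True"

definition less_p1r :: "p1r \<Rightarrow> p1r \<Rightarrow> bool" where
  "x < y \<longleftrightarrow> x \<le> y \<and> \<not> y \<le> (x::p1r)"

instance
proof
  fix x y z :: p1r
  show "x < y \<longleftrightarrow> x \<le> y \<and> \<not> y \<le> x" by (rule less_p1r_def)
  show "x \<le> x" by (cases x) auto
  show "x \<le> y \<Longrightarrow> y \<le> z \<Longrightarrow> x \<le> z" by (cases x; cases y; cases z) auto
  show "x \<le> y \<Longrightarrow> y \<le> x \<Longrightarrow> x = y" by (cases x; cases y) auto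
  show "x \<le> y \<or> y \<le> x" by (cases x; cases y) auto
qed

end

lemma less_p1r_simps [simp]:
  "Fin x < Fin y \<longleftrightarrow> x < y" "Fin x < Infty" "\<not> Infty < z"
  by (cases z; auto simp: less_p1r_def)+

fun moebius_mat :: "real^2^2 \<Rightarrow> p1r \<Rightarrow> p1r" where
  "moebius_mat M (Fin x) =
     (if M$2$1 * x + M$2$2 = 0 then Infty
      else Fin ((M$1$1 * x + M$1$2) / (M$2$1 * x + M$2$2)))"
| "moebius_mat M Infty = (if M$2$1 = 0 then Infty else Fin (M$1$1 / M$2$1))"

lemma moebius_mat_uminus: "moebius_mat (- M) z = moebius_mat M z"
proof (cases z)
  case (Fin x)
  have "(- (M$1$1 * x) - M$1$2) / (- (M$2$1 * x) - M$2$2) =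
      (M$1$1 * x + M$1$2) / (M$2$1 * x + M$2$2)"
    using minus_divide_divide[of "M$1$1 * x + M$1$2" "M$2$1 * x + M$2$2"] by simp
  moreover have "- (M$2$1 * x) - M$2$2 = 0 \<longleftrightarrow> M$2$1 * x + M$2$2 = 0"
    by linarith
  ultimately show ?thesis
    unfolding Fin by simp
qed simp

lift_definition act_p1r :: "psl2r \<Rightarrow> p1r \<Rightarrow> p1r" is moebius_mat
  by (auto simp: moebius_mat_uminus)

section \<open>Hecke triangle groups\<close>

definition hecke_lambda :: "nat \<Rightarrow> real" where
  "hecke_lambda q = 2 * cos (pi / real q)"

lift_definition hecke_S :: psl2r is "mat2 0 1 (- 1) 0"
  by (simp add: det_2)

lift_definition hecke_T :: "nat \<Rightarrow> psl2r" is "\<lambda>q. mat2 1 (hecke_lambda q) 0 1"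
  by (simp add: det_2)

inductive_set hecke_group :: "nat \<Rightarrow> psl2r set" for q :: nat where
  "1 \<in> hecke_group q"
| "hecke_S \<in> hecke_group q"
| "hecke_T q \<in> hecke_group q"
| "g \<in> hecke_group q \<Longrightarrow> inverse g \<in> hecke_group q"
| "g \<in> hecke_group q \<Longrightarrow> h \<in> hecke_group q \<Longrightarrow> g * h \<in> hecke_group q"

definition hecke_hyperbolic :: "nat \<Rightarrow> psl2r set" where
  "hecke_hyperbolic q = hecke_group q \<inter> hyperbolic"

definition has_level :: "nat \<Rightarrow> psl2r \<Rightarrow> nat \<Rightarrow> bool" where
  "has_level q g n \<longleftrightarrow>
     (\<exists>h\<in>hecke_group q. g = h ^ n) \<and> (\<forall>n'. (\<exists>h\<in>hecke_group q. g = h ^ n') \<longrightarrow> n' \<le> n)"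

definition hecke_U :: "nat \<Rightarrow> psl2r" where
  "hecke_U q = hecke_T q * hecke_S"

definition hecke_g :: "nat \<Rightarrow> int \<Rightarrow> psl2r" where
  "hecke_g q k = inverse (hecke_U q powi k * hecke_S)"


section \<open>Projective oriented quadratic forms\<close>

text \<open>A quadruple \<open>(A, B, C, s)\<close> stands for the form \<open>A x\<^sup>2 + B x y + C y\<^sup>2\<close> together
  with the sign \<open>s\<close>, which is a real number to avoid coercions.\<close>

type_synonym oqf = "real \<times> real \<times> real \<times> real"

definition discr :: "real \<Rightarrow> real \<Rightarrow> real \<Rightarrow> real" where
  "discr A B C = B\<^sup>2 - 4 * A * C"

lemma discr_uminus [simp]: "discr (- A) (- B) (- C) = discr A B C"
  by (simp add: discr_def)

fun is_oqf :: "oqf \<Rightarrow> bool" where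
  "is_oqf (A, B, C, s) \<longleftrightarrow> discr A B C > 0 \<and> s \<in> {1, -1}"

quotient_type poqf = oqf / partial: "\<lambda>f f'. is_oqf f \<and> (f' = f \<or> f' = - f)"
proof (rule part_equivpI)
  show "\<exists>f. is_oqf f \<and> (f = f \<or> f = - f)"
    by (rule exI[of _ "(1, 0, -1, 1)"]) (simp add: discr_def)
qed (auto intro!: sympI transpI simp: discr_def)

definition x_plus :: "real \<Rightarrow> real \<Rightarrow> real \<Rightarrow> p1r" where
  "x_plus A B C =
     (if A \<noteq> 0 then Fin ((- B + sqrt (discr A B C)) / (2 * A))
      else if B > 0 then Fin (- C / B) else Infty)"

definition x_minus :: "real \<Rightarrow> real \<Rightarrow> real \<Rightarrow> p1r" where
  "x_minus A B C =
     (if A \<noteq> 0 then Fin ((- B - sqrt (discr A B C)) / (2 * A))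
      else if B > 0 then Infty else Fin (- C / B))"

lemma x_uminus:
  assumes "discr A B C > 0"
  shows "x_plus (- A) (- B) (- C) = x_minus A B C" "x_minus (- A) (- B) (- C) = x_plus A B C"
  using assms by (auto simp: x_plus_def x_minus_def discr_def field_simps)

lift_definition x_att :: "poqf \<Rightarrow> p1r" is
  "\<lambda>(A, B, C, s). if s = 1 then x_plus A B C else x_minus A B C"
  by (auto simp: x_uminus)

lift_definition x_rep :: "poqf \<Rightarrow> p1r" is
  "\<lambda>(A, B, C, s). if s = 1 then x_minus A B C else x_plus A B C"
  by (auto simp: x_uminus)

definition phi2 :: "poqf \<Rightarrow> p1r \<times> p1r" where
  "phi2 F = (x_att F, x_rep F)"

definition reduced :: "poqf \<Rightarrow> bool" where
  "reduced F \<longleftrightarrow> x_att F > Fin 0 \<and> Fin 0 > x_rep F"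

fun oqf_form :: "oqf \<Rightarrow> real \<Rightarrow> real \<Rightarrow> real" where
  "oqf_form (A, B, C, s) x y = A * x\<^sup>2 + B * x * y + C * y\<^sup>2"

fun oqf_sign :: "oqf \<Rightarrow> real" where
  "oqf_sign (A, B, C, s) = s"

text \<open>The coefficients of \<open>f(d x - b y, - c x + a y)\<close>; see the next lemma.\<close>

fun act_oqf :: "real^2^2 \<Rightarrow> oqf \<Rightarrow> oqf" where
  "act_oqf M (A, B, C, s) =
    (let a = M$1$1; b = M$1$2; c = M$2$1; d = M$2$2 in
     (A * d\<^sup>2 - B * c * d + C * c\<^sup>2,
      - 2 * A * b * d + B * (a * d + b * c) - 2 * C * a * c,
      A * b\<^sup>2 - B * a * b + C * a\<^sup>2,
      s))"

lemma oqf_form_act: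
  "oqf_form (act_oqf M f) x y = oqf_form f (M$2$2 * x - M$1$2 * y) (- M$2$1 * x + M$1$1 * y)"
  "oqf_sign (act_oqf M f) = oqf_sign f"
  by (cases f; simp add: Let_def power2_eq_square algebra_simps)+

lemma discr_act:
  "case act_oqf M (A, B, C, s) of (A', B', C', s') \<Rightarrow>
     discr A' B' C' = (det M)\<^sup>2 * discr A B C"
  by (simp add: Let_def discr_def det_2 power2_eq_square algebra_simps)

lift_definition act_poqf :: "psl2r \<Rightarrow> poqf \<Rightarrow> poqf" is act_oqf
proof (goal_cases)
  case (1 M N f f')
  obtain A B C s where f: "f = (A, B, C, s)" by (metis prod_cases4)
  have "is_oqf (act_oqf M f)"
    using 1 discr_act[of M A B C s] by (auto simp: f Let_def)
  moreover have "act_oqf (- M) f = act_oqf M f" "act_oqf M (- f) = - act_oqf M f"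
    "act_oqf (- M) (- f) = - act_oqf M f"
    by (cases f; simp add: Let_def algebra_simps)+
  ultimately show ?case using 1 by auto
qed

lift_definition psi2 :: "poqf \<Rightarrow> psl2r" is
  "\<lambda>(A, B, C, s).
     mat2 ((- B + s * sqrt (discr A B C + 4)) / 2) (- C)
          A ((B + s * sqrt (discr A B C + 4)) / 2)"
proof (clarsimp, goal_cases)
  case (1 A B C s A' B' C' s')
  define r where "r = sqrt (discr A B C + 4)"
  have "r\<^sup>2 = B\<^sup>2 - 4 * A * C + 4" "s\<^sup>2 = 1"
    using 1 by (auto simp: r_def discr_def)
  then have "s\<^sup>2 * r\<^sup>2 = B\<^sup>2 - 4 * A * C + 4" by simp
  then have "det (mat2 ((s * r - B) / 2) (- C) A ((B + s * r) / 2)) = 1"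
    by (simp add: det_2 power2_eq_square field_simps)
  moreover have "mat2 ((- (s * r) + B) / 2) C (- A) ((- B - s * r) / 2) =
      - mat2 ((s * r - B) / 2) (- C) A ((B + s * r) / 2)"
    by (simp add: vec_eq_iff forall_2 field_simps)
  ultimately show ?case
    using 1 by (auto simp: add.commute[of r] simp flip: r_def)
qed

text \<open>The inverse of \<open>psi2\<close> is a partial function, defined on hyperbolic elements only.\<close>

lift_definition psi2_inv :: "psl2r \<Rightarrow> poqf option" is
  "\<lambda>M. if \<bar>trace M\<bar> > 2 then Some (M$2$1, M$2$2 - M$1$1, - M$1$2, sgn (M$1$1 + M$2$2)) else None"
proof (goal_cases)
  case (1 M N)
  have *: "(d - a)\<^sup>2 - 4 * c * (- b) > 0"
    if "\<bar>a + d\<bar> > 2" "a * d - b * c = 1" for a b c d :: real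
  proof -
    have "(d - a)\<^sup>2 - 4 * c * (- b) = \<bar>a + d\<bar>\<^sup>2 - 4 * (a * d - b * c)"
      by (simp add: power2_eq_square algebra_simps)
    moreover have "\<bar>a + d\<bar>\<^sup>2 > 2\<^sup>2" using that by (intro power_strict_mono) auto
    ultimately show ?thesis using that by simp
  qed
  show ?case
    using 1 *[of "M$1$1" "M$2$2" "M$1$2" "M$2$1"]
    by (auto simp: trace_def sum_2 det_2 sgn_if discr_def)
qed

lemma psi2_hyperbolic: "psi2 F \<in> hyperbolic"
proof -
  have "abs_trace (psi2 F) > 2"
  proof (transfer, clarsimp, goal_cases)
    case (1 A B C s)
    have "sqrt (discr A B C + 4) > sqrt 4" using 1 by (intro real_sqrt_less_mono) simp
    then show ?case using 1 by (auto simp: trace_def sum_2 field_simps)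
  qed
  then show ?thesis by (simp add: hyperbolic_def)
qed

lemma psi2_inv_eq_None_iff: "psi2_inv g = None \<longleftrightarrow> g \<notin> hyperbolic"
proof -
  have "(case psi2_inv g of None \<Rightarrow> True | Some F \<Rightarrow> False) \<longleftrightarrow> \<not> abs_trace g > 2"
    by transfer auto
  then show ?thesis by (simp add: hyperbolic_def split: option.splits)
qed

lemma psi2_inv_iff: "psi2_inv g = Some F \<longleftrightarrow> psi2 F = g"
proof -
  have 1: "case psi2_inv (psi2 F) of None \<Rightarrow> False | Some F' \<Rightarrow> F' = F"
  proof (transfer, clarsimp, goal_cases)
    case (1 A B C s)
    define t where "t = s * sqrt (discr A B C + 4)"
    have "sqrt (discr A B C + 4) > sqrt 4" using 1 by (intro real_sqrt_less_mono) simp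
    then have "\<bar>t\<bar> > 2" "sgn t = s"
      using 1 by (auto simp: t_def)
    moreover have "(t - B) / 2 + (B + t) / 2 = t" "(B + t) / 2 - (t - B) / 2 = B"
      by (simp_all add: field_simps)
    ultimately show ?case
      using 1 by (simp add: trace_def sum_2 flip: t_def)
  qed
  have 2: "case psi2_inv g of None \<Rightarrow> True | Some F' \<Rightarrow> psi2 F' = g"
  proof (transfer, goal_cases)
    case (1 M)
    define a b c d where abcd: "a = M$1$1" "b = M$1$2" "c = M$2$1" "d = M$2$2"
    have M: "M = mat2 a b c d" by (simp add: abcd vec_eq_iff forall_2)
    have det: "a * d - b * c = 1" using 1 by (simp add: det_2 M)
    have "discr c (d - a) (- b) + 4 = (a + d)\<^sup>2"
      using det by (simp add: discr_def power2_eq_square algebra_simps)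
    then have r: "sgn (a + d) * sqrt (discr c (d - a) (- b) + 4) = a + d"
      by (simp add: sgn_mult_abs)
    have "mat2 ((- (d - a) + (a + d)) / 2) b c (((d - a) + (a + d)) / 2) = M"
      by (simp add: M)
    then show ?case
      using 1 by (simp add: r flip: abcd)
  qed
  show ?thesis
  proof
    assume "psi2_inv g = Some F"
    with 2 show "psi2 F = g" by simp
  next
    assume "psi2 F = g"
    with 1 show "psi2_inv g = Some F" by (cases "psi2_inv g") simp_all
  qed
qed

lemma psi2_act: "psi2 (act_poqf g F) = g * psi2 F * inverse g"
proof (transfer, goal_cases)
  case (1 M f)
  define a b c d where abcd: "a = M$1$1" "b = M$1$2" "c = M$2$1" "d = M$2$2"
  have M: "M = mat2 a b c d" by (simp add: abcd vec_eq_iff forall_2)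
  have det: "a * d = 1 + b * c" using 1 by (simp add: det_2 M)
  obtain A B C s where f: "f = (A, B, C, s)" by (metis prod_cases4)
  obtain A' B' C' where f': "act_oqf M f = (A', B', C', s)" by (simp add: f Let_def)
  have D: "discr A' B' C' = discr A B C"
    using discr_act[of M A B C s] f' 1 by (simp add: f)
  define t where "t = s * sqrt (discr A B C + 4)"
  have A': "A' = A * d\<^sup>2 - B * c * d + C * c\<^sup>2"
    and B': "B' = - 2 * A * b * d + B * (a * d + b * c) - 2 * C * a * c"
    and C': "C' = A * b\<^sup>2 - B * a * b + C * a\<^sup>2"
    using f' by (simp_all add: f M Let_def)
  have "- B' + t = (a * (- B + t) + b * (2 * A)) * d - (- 2 * (a * C) + b * (B + t)) * c"
    unfolding B' using det by algebra
  moreover have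
    "- 2 * C' = - (a * (- B + t) + b * (2 * A)) * b + (- 2 * (a * C) + b * (B + t)) * a"
    unfolding C' by algebra
  moreover have
    "2 * A' = (c * (- B + t) + d * (2 * A)) * d - (- 2 * (c * C) + d * (B + t)) * c"
    unfolding A' by algebra
  moreover have
    "B' + t = - (c * (- B + t) + d * (2 * A)) * b + (- 2 * (c * C) + d * (B + t)) * a"
    unfolding B' using det by algebra
  ultimately have eq: "mat2 ((- B' + t) / 2) (- C') A' ((B' + t) / 2) =
      M ** mat2 ((- B + t) / 2) (- C) A ((B + t) / 2) ** mat2 d (- b) (- c) a"
    by (simp add: M vec_eq_iff forall_2 matrix_matrix_mult_def sum_2 field_simps)
  have "A * C * 4 = B\<^sup>2 - discr A B C" "(sqrt (discr A B C + 4))\<^sup>2 = discr A B C + 4" "s\<^sup>2 = 1"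
    using 1 by (auto simp: discr_def f)
  then have "t\<^sup>2 = B\<^sup>2 - 4 * A * C + 4"
    by (simp add: t_def power_mult_distrib)
  then have "det (mat2 ((- B + t) / 2) (- C) A ((B + t) / 2)) = 1"
    by (simp add: det_2 field_simps power2_eq_square)
  moreover have "det (mat2 d (- b) (- c) a) = 1" using det by (simp add: det_2 mult.commute)
  ultimately have "det (M ** mat2 ((- B + t) / 2) (- C) A ((B + t) / 2) ** mat2 d (- b) (- c) a) = 1"
    using 1 by (simp add: det_mul)
  then show ?case
    using eq by (simp add: f'[unfolded f] D f t_def del: act_oqf.simps flip: abcd)
qed

definition hecke_forms :: "nat \<Rightarrow> poqf set" where
  "hecke_forms q = psi2 -` hecke_hyperbolic q"

definition hecke_equiv :: "nat \<Rightarrow> poqf \<Rightarrow> poqf \<Rightarrow> bool" where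
  "hecke_equiv q F F' \<longleftrightarrow> (\<exists>g\<in>hecke_group q. F' = act_poqf g F)"

section \<open>The reduction algorithm\<close>

text \<open>
  The algorithm is written in the option monad. The value \<open>None\<close> stands for each way in which
  a run can fail: a loop that does not terminate (the loops are least fixed points in the flat
  order with bottom \<open>None\<close>), an undefined interval number, or the inverse of \<open>psi2\<close>
  applied to an element that is not hyperbolic.
\<close>

definition interval :: "nat \<Rightarrow> p1r \<Rightarrow> int option" where
  "interval q x =
    (let P = (\<lambda>k. k \<in> {1..int q - 1} \<and>
        x \<in> {act_p1r (inverse (hecke_g q k)) (Fin 0) <..< act_p1r (inverse (hecke_g q k)) Infty})
     in if \<exists>!k. P k then Some (THE k. P k) else None)"

text \<open>\<open>Fs\<close> is the list of the forms \<open>F\<^sub>0, \<dots>, F\<^sub>j\<close>, and \<open>x\<close>, \<open>y\<close>, \<open>h\<close> are the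
  current values \<open>x\<^sub>j\<close>, \<open>y\<^sub>j\<close>, \<open>h\<^sub>j\<close>.\<close>

partial_function (option) preperiod_loop ::
  "nat \<Rightarrow> poqf list \<Rightarrow> p1r \<Rightarrow> p1r \<Rightarrow> psl2r \<Rightarrow> (poqf list \<times> p1r \<times> p1r \<times> psl2r) option"
where
  "preperiod_loop q Fs x y h =
    (if reduced (last Fs) then Some (Fs, x, y, h)
     else do {
       k \<leftarrow> interval q x;
       preperiod_loop q (Fs @ [act_poqf (hecke_g q k) (last Fs)])
         (act_p1r (hecke_g q k) x) (act_p1r (hecke_g q k) y) (h * inverse (hecke_g q k))
     })"

text \<open>Here \<open>z\<close> is the pair \<open>(x\<^sub>m, y\<^sub>m)\<close>, \<open>F\<close> is the current form \<open>F\<^sub>j\<close>, and \<open>Fs\<close> is the list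
  of the forms \<open>F\<^bsub>m+1\<^esub>, \<dots>, F\<^sub>j\<close>. The exit test comes after the body of the loop.\<close>

partial_function (option) period_loop ::
  "nat \<Rightarrow> p1r \<times> p1r \<Rightarrow> poqf list \<Rightarrow> poqf \<Rightarrow> p1r \<Rightarrow> p1r \<Rightarrow> psl2r \<Rightarrow> (poqf list \<times> psl2r) option"
where
  "period_loop q z Fs F x y a = do {
     k \<leftarrow> interval q x;
     let F' = act_poqf (hecke_g q k) F;
     let x' = act_p1r (hecke_g q k) x;
     let y' = act_p1r (hecke_g q k) y;
     let a' = a * inverse (hecke_g q k);
     (if (x', y') = z then Some (Fs @ [F'], a')
      else period_loop q z (Fs @ [F']) F' x' y' a')
   }"

partial_function (option) level_loop ::
  "poqf \<Rightarrow> psl2r \<Rightarrow> psl2r \<Rightarrow> nat \<Rightarrow> nat option"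
where
  "level_loop F h a n = do {
     F' \<leftarrow> psi2_inv (h * a ^ n * inverse h);
     (if F' \<noteq> F then level_loop F h a (n + 1) else Some n)
   }"

text \<open>The output consists of the level, the preperiod \<open>F\<^sub>0, \<dots>, F\<^sub>m\<close>, the period
  \<open>F\<^bsub>m+1\<^esub>, \<dots>, F\<^bsub>m+p\<^esub>\<close> and the associated hyperbolic element.\<close>

definition reduction_algorithm ::
  "nat \<Rightarrow> poqf \<Rightarrow> (nat \<times> poqf list \<times> poqf list \<times> psl2r) option"
where
  "reduction_algorithm q F = do {
     let (x0, y0) = phi2 F;
     (Fs, xm, ym, hm) \<leftarrow>
       (if x0 < Fin 0
        then preperiod_loop q [F, act_poqf hecke_S F] (act_p1r hecke_S x0) (act_p1r hecke_S y0)
          hecke_S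
        else preperiod_loop q [F] x0 y0 1);
     (Ps, ap) \<leftarrow> period_loop q (xm, ym) [] (last Fs) xm ym 1;
     n \<leftarrow> level_loop F hm ap 1;
     Some (n, Fs, Ps, hm * ap ^ n * inverse hm)
   }"

end

theory Submission
  imports Defs
begin

text \<open>
  The proof translates the algorithm into operations on words. Write
  \<open>V\<^sub>k = U\<^sup>k S\<close> for \<open>1 \<le> k \<le> q - 1\<close>. Since \<open>S\<^sup>2 = U\<^sup>q = 1\<close>, every element of the Hecke
  group is a product of \<open>V\<^sub>k\<close>'s, possibly with a factor \<open>S\<close> at either end
  (\<open>hecke_groupE\<close>). The matrices of the \<open>V\<^sub>k\<close> have nonnegative entries and diagonal entries at
  least \<open>1\<close>, so products of them map the positive half line into itself; moreover the images
  \<open>V\<^sub>k (0, \<infinity>)\<close> are pairwise disjoint, and \<open>interval\<close> just reads off which of them contains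
  a point. Hence a word in the \<open>V\<^sub>k\<close> is determined by the element it represents, and its
  letters are the interval numbers that occur along the orbit of its attracting fixed point
  (\<open>word_psl_prefix_unique\<close>, \<open>word_psl_inj\<close>).

  Because the action is equivariant (\<open>x_att_act\<close>, \<open>x_rep_act\<close>), everything can be said about
  the hyperbolic element \<open>\<psi>\<^sub>2(F)\<close>. A \<open>\<Gamma>\<close>-form is reduced if and only if this element is a
  word in the \<open>V\<^sub>k\<close>, with no \<open>S\<close> at the ends (\<open>reduced_iff_word\<close>): a hyperbolic nonnegative
  matrix has its attracting fixed point in \<open>(0, \<infinity>)\<close> and the repelling one in \<open>(-\<infinity>, 0)\<close>,
  while \<open>w S\<close> has both fixed points positive, \<open>S w\<close> has both negative, and \<open>S w S\<close> has them
  the wrong way round. In particular no fixed point is a cusp where the interval number would be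
  undefined.

  The preperiod starts by removing a leading \<open>S\<close>. A step of its loop conjugates \<open>w S\<close> by the first
  letter of \<open>w\<close>, which merges this letter with the last one and shortens the word, so the loop
  stops (\<open>preperiod_step\<close>). Once the form is reduced, a step conjugates a word by its first
  letter, that is, it rotates the word. The loop therefore runs through the distinct rotations of
  the word and returns after the least period. These are all reduced forms in the orbit, because
  conjugate words are rotations of each other (\<open>conjugate_reduced_words\<close>).

  Finally a word is the power of its primitive root \<open>a\<close>, the prefix whose length is the least
  period, and the exponent is the level: a root of the word commutes with it, hence fixes both
  its fixed points, hence is itself a word or the inverse of one; it cannot be the inverse of one,
  and the length of a word that is a root is at least the least period (\<open>level_le\<close>).
\<close>

section \<open>The group PSL(2,R) and its action\<close>

lemma psl2r_right_inverse: "g * inverse g = (1::psl2r)"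
  by transfer (auto simp: det_2 vec_eq_iff forall_2 matrix_matrix_mult_def sum_2 mat_def
      algebra_simps)

lemma psl2r_cancel_left [simp]: "inverse g * (g * h) = h" "g * (inverse g * h) = (h::psl2r)"
  by (simp_all add: psl2r_left_inverse psl2r_right_inverse flip: mult.assoc)

lemma psl2r_inverse_unique: "g * h = 1 \<Longrightarrow> inverse g = (h::psl2r)"
  by (metis psl2r_cancel_left(1) mult_1_right)

lemma psl2r_inverse_inverse [simp]: "inverse (inverse g) = (g::psl2r)"
  by (intro psl2r_inverse_unique psl2r_left_inverse)

lemma psl2r_inverse_mult: "inverse (g * h) = inverse h * inverse (g::psl2r)"
  by (intro psl2r_inverse_unique) (simp add: mult.assoc psl2r_right_inverse)

lemma psl2r_inverse_1 [simp]: "inverse 1 = (1::psl2r)"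
  by (intro psl2r_inverse_unique) simp

lemma psl2r_mult_left_cancel [simp]: "g * h = g * k \<longleftrightarrow> h = (k::psl2r)"
  by (metis psl2r_cancel_left(1))

lemma psl2r_mult_right_cancel [simp]: "h * g = k * g \<longleftrightarrow> h = (k::psl2r)"
  by (metis mult.assoc mult_1_right psl2r_right_inverse)

lemma psl2r_conj_power: "(h * g * inverse h) ^ n = h * g ^ n * inverse (h::psl2r)"
  by (induction n) (simp_all add: psl2r_right_inverse mult.assoc)

text \<open>
  Homogeneous coordinates linearise the action: a matrix sends the coordinates of \<open>z\<close> to a
  multiple of the coordinates of its image, and the multiplier is the automorphy factor
  \<open>factor_mat\<close>. Uniqueness of the multiplier gives both the action law and the cocycle law. At a
  fixed point the multiplier is an eigenvalue, so its absolute value, which survives in the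
  projective group, tells attracting from repelling.
\<close>

definition hom_coords :: "p1r \<Rightarrow> real^2" where
  "hom_coords z = (case z of Fin x \<Rightarrow> vector [x, 1] | Infty \<Rightarrow> vector [1, 0])"

fun factor_mat :: "real^2^2 \<Rightarrow> p1r \<Rightarrow> real" where
  "factor_mat M (Fin x) =
     (if M$2$1 * x + M$2$2 = 0 then M$1$1 * x + M$1$2 else M$2$1 * x + M$2$2)"
| "factor_mat M Infty = (if M$2$1 = 0 then M$1$1 else M$2$1)"

lemma hom_nth [simp]:
  "hom_coords (Fin x) $ 1 = x" "hom_coords (Fin x) $ 2 = 1" "hom_coords Infty $ 1 = 1" "hom_coords Infty $ 2 = 0"
  by (simp_all add: hom_coords_def vector_2)

lemma hom_moebius: "M *v hom_coords z = factor_mat M z *s hom_coords (moebius_mat M z)"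
  by (cases z) (auto simp: vec_eq_iff forall_2 matrix_vector_mult_def sum_2)

lemma scaled_hom_eq:
  assumes "a *s hom_coords z = b *s hom_coords w" "a \<noteq> 0"
  shows "z = w \<and> a = b"
  using assms by (cases z; cases w) (auto simp: vec_eq_iff forall_2)

lemma factor_mat_nonzero: "det M = 1 \<Longrightarrow> factor_mat M z \<noteq> 0"
proof (cases z)
  case (Fin x)
  assume d: "det M = 1"
  have "M$1$1 * (M$2$1 * x + M$2$2) - M$2$1 * (M$1$1 * x + M$1$2) = det M"
    by (simp add: det_2 algebra_simps)
  then show ?thesis using d Fin by auto
qed (auto simp: det_2)

lemma factor_mat_uminus: "factor_mat (- M) z = - factor_mat M z"
proof (cases z)
  case (Fin x)
  have "- (M$2$1 * x) - M$2$2 = 0 \<longleftrightarrow> M$2$1 * x + M$2$2 = 0"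
    by linarith
  then show ?thesis by (simp add: Fin)
qed simp

lemma moebius_mat_mult:
  assumes "det M = 1" "det N = 1"
  shows "moebius_mat (M ** N) z = moebius_mat M (moebius_mat N z)"
    and "factor_mat (M ** N) z = factor_mat M (moebius_mat N z) * factor_mat N z"
proof -
  have "factor_mat (M ** N) z *s hom_coords (moebius_mat (M ** N) z) = M *v (N *v hom_coords z)"
    by (simp add: hom_moebius[symmetric] matrix_vector_mul_assoc)
  also have "\<dots> = (factor_mat M (moebius_mat N z) * factor_mat N z)
      *s hom_coords (moebius_mat M (moebius_mat N z))"
    by (simp add: hom_moebius vector_scalar_commute mult.commute)
  finally have "moebius_mat (M ** N) z = moebius_mat M (moebius_mat N z) \<and>
      factor_mat (M ** N) z = factor_mat M (moebius_mat N z) * factor_mat N z"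
    by (rule scaled_hom_eq) (simp add: factor_mat_nonzero det_mul assms)
  then show "moebius_mat (M ** N) z = moebius_mat M (moebius_mat N z)"
    and "factor_mat (M ** N) z = factor_mat M (moebius_mat N z) * factor_mat N z" by auto
qed

lift_definition act_factor :: "psl2r \<Rightarrow> p1r \<Rightarrow> real" is "\<lambda>M z. \<bar>factor_mat M z\<bar>"
  by (auto simp: factor_mat_uminus)

lemma act_p1r_mult: "act_p1r (g * h) z = act_p1r g (act_p1r h z)"
  by transfer (auto simp: moebius_mat_mult)

lemma act_p1r_one [simp]: "act_p1r 1 z = z"
  by (transfer, rename_tac z, case_tac z) (auto simp: mat_def)

lemma act_p1r_inverse [simp]:
  "act_p1r (inverse g) (act_p1r g z) = z" "act_p1r g (act_p1r (inverse g) z) = z"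
  by (simp_all add: psl2r_left_inverse psl2r_right_inverse flip: act_p1r_mult)

lemma act_factor_mult: "act_factor (g * h) z = act_factor g (act_p1r h z) * act_factor h z"
  by transfer (auto simp: moebius_mat_mult abs_mult)

lemma act_factor_one [simp]: "act_factor 1 z = 1"
  by (transfer, rename_tac z, case_tac z) (auto simp: mat_def)

lemma act_factor_conj: "act_factor (h * g * inverse h) (act_p1r h z) = act_factor g z"
  if "act_p1r g z = z"
proof -
  have "act_factor (h * inverse h) (act_p1r h z) = 1"
    by (simp add: psl2r_right_inverse)
  then have "act_factor h z * act_factor (inverse h) (act_p1r h z) = 1"
    by (simp add: act_factor_mult)
  then show ?thesis
    by (simp add: act_factor_mult act_p1r_mult that mult_ac)
qed

text \<open>The two eigenvalues of a matrix of determinant \<open>1\<close> are inverse to each other.\<close>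

lemma moebius_mat_two_fixed_points:
  assumes "det M = 1" "moebius_mat M z = z" "moebius_mat M w = w" "z \<noteq> w"
  shows "factor_mat M z * factor_mat M w = 1"
proof -
  have cross: "(M *v v)$1 * (M *v u)$2 - (M *v v)$2 * (M *v u)$1 =
      det M * (v$1 * u$2 - v$2 * u$1)" for v u
    by (simp add: det_2 matrix_vector_mult_def sum_2 algebra_simps)
  have "hom_coords z $ 1 * hom_coords w $ 2 - hom_coords z $ 2 * hom_coords w $ 1 \<noteq> 0"
    using assms(4) by (cases z; cases w) auto
  moreover have "factor_mat M z * factor_mat M w *
      (hom_coords z $ 1 * hom_coords w $ 2 - hom_coords z $ 2 * hom_coords w $ 1) = hom_coords z $ 1 * hom_coords w $ 2 - hom_coords z $ 2 * hom_coords w $ 1"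
    using cross[of "hom_coords z" "hom_coords w"] assms by (simp add: hom_moebius algebra_simps)
  ultimately show ?thesis by simp
qed

lemma two_fixed_points:
  "act_p1r g z = z \<Longrightarrow> act_p1r g w = w \<Longrightarrow> z \<noteq> w \<Longrightarrow> act_factor g z * act_factor g w = 1"
  by transfer (auto simp: moebius_mat_two_fixed_points simp flip: abs_mult)

section \<open>Attracting and repelling fixed points\<close>

lemma hom_x_plus:
  assumes "discr A B C > 0"
  shows "mat2 ((- B + t) / 2) (- C) A ((B + t) / 2) *v hom_coords (x_plus A B C) =
     ((t + sqrt (discr A B C)) / 2) *s hom_coords (x_plus A B C)"
proof -
  define r where "r = sqrt (discr A B C)"
  have r: "r\<^sup>2 = B\<^sup>2 - 4 * A * C" using assms by (simp add: discr_def r_def)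
  show ?thesis
  proof (cases "A = 0")
    case False
    define x where "x = (- B + r) / (2 * A)"
    have x: "x_plus A B C = Fin x" using False by (simp add: x_plus_def x_def r_def)
    have Ax: "2 * A * x = r - B" using False by (simp add: x_def)
    have "2 * A * ((- B + t) / 2 * x - C) = 2 * A * ((t + r) / 2 * x)"
      using Ax r by algebra
    then have "(- B + t) / 2 * x - C = (t + r) / 2 * x" using False by simp
    then show ?thesis unfolding x r_def[symmetric]
      using Ax by (simp add: vec_eq_iff forall_2 matrix_vector_mult_def sum_2 field_simps)
  next
    case True
    then have "r = \<bar>B\<bar>" by (simp add: discr_def r_def)
    moreover have "B \<noteq> 0" using True assms by (auto simp: discr_def)
    ultimately show ?thesis unfolding r_def[symmetric] using True
      by (simp add: x_plus_def vec_eq_iff forall_2 matrix_vector_mult_def sum_2 field_simps)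
  qed
qed

text \<open>Negating the form and \<open>t\<close> negates the matrix and exchanges the two zeros.\<close>

lemma hom_x_minus:
  assumes "discr A B C > 0"
  shows "mat2 ((- B + t) / 2) (- C) A ((B + t) / 2) *v hom_coords (x_minus A B C) =
     ((t - sqrt (discr A B C)) / 2) *s hom_coords (x_minus A B C)"
proof -
  have "- mat2 ((- B + t) / 2) (- C) A ((B + t) / 2) = mat2 ((B - t) / 2) C (-A) ((- B - t) / 2)"
    by (simp add: vec_eq_iff forall_2 field_simps)
  then have 1: "mat2 ((- B + t) / 2) (- C) A ((B + t) / 2) = - mat2 ((B - t) / 2) C (-A) ((- B - t) / 2)"
    by (metis minus_minus)
  show ?thesis
    using hom_x_plus[of "-A" "-B" "-C" "-t"] assms unfolding x_uminus[OF assms]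
    by (simp add: 1 vec_eq_iff forall_2 matrix_vector_mult_def sum_2 field_simps)
qed

lemma moebius_mat_eigen:
  assumes "M *v hom_coords z = a *s hom_coords z" "a \<noteq> 0"
  shows "moebius_mat M z = z" "factor_mat M z = a"
  using scaled_hom_eq[of a z "factor_mat M z" "moebius_mat M z"] assms
  by (auto simp: hom_moebius)

text \<open>
  These numbers are the eigenvalues of the matrix \<open>\<psi>\<^sub>2(F)\<close> of a form \<open>F\<close>
  with sign \<open>s\<close> and discriminant \<open>d\<close>, at the zeros that are called attracting and repelling.
\<close>

lemma eigenvalue_bounds:
  assumes "(d::real) > 0" "s = 1 \<or> s = -1"
  shows "\<bar>(s * sqrt (d + 4) + s * sqrt d) / 2\<bar> > 1"
    "\<bar>(s * sqrt (d + 4) - s * sqrt d) / 2\<bar> < 1" "(s * sqrt (d + 4) - s * sqrt d) / 2 \<noteq> 0"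
proof -
  have "sqrt (d + 4) > sqrt 4" using assms by (intro real_sqrt_less_mono) auto
  then have 1: "sqrt (d + 4) > 2" "sqrt d > 0" "sqrt (d+4) > sqrt d" using assms by auto
  have "sqrt (d+4) < sqrt d + 2"
    using 1 assms by (intro real_less_lsqrt) (auto simp: power2_eq_square algebra_simps)
  with 1 assms(2) show "\<bar>(s * sqrt (d + 4) + s * sqrt d) / 2\<bar> > 1"
    "\<bar>(s * sqrt (d + 4) - s * sqrt d) / 2\<bar> < 1" "(s * sqrt (d + 4) - s * sqrt d) / 2 \<noteq> 0"
    by auto
qed

lemma poqf_cases:
  obtains A B C s where "F = abs_poqf (A, B, C, s)" "discr A B C > 0" "s = 1 \<or> s = -1"
proof -
  have "\<exists>A B C s. F = abs_poqf (A, B, C, s) \<and> discr A B C > 0 \<and> (s = 1 \<or> s = -1)"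
  proof (induct F rule: poqf.abs_induct)
    case (1 f)
    then show ?case by (cases f) auto
  qed
  with that show ?thesis by blast
qed

context
  fixes A B C s t :: real and M :: "real^2^2" and F :: poqf
  assumes form: "discr A B C > 0" "s = 1 \<or> s = -1"
  defines "t \<equiv> s * sqrt (discr A B C + 4)"
  defines "M \<equiv> mat2 ((- B + t) / 2) (- C) A ((B + t) / 2)"
  defines "F \<equiv> abs_poqf (A, B, C, s)"
begin

lemma det_psi2_matrix: "det M = 1"
proof -
  have "(sqrt (discr A B C + 4))\<^sup>2 = B\<^sup>2 - 4 * A * C + 4" "s\<^sup>2 = 1"
    using form by (auto simp: discr_def)
  then have "t\<^sup>2 = B\<^sup>2 - 4 * A * C + 4" by (simp add: t_def power_mult_distrib)
  then show ?thesis by (simp add: M_def det_2 field_simps power2_eq_square)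
qed

lemma psi2_abs: "psi2 F = abs_psl2r M"
  unfolding F_def using form by (subst psi2.abs_eq) (auto simp: M_def t_def)

lemma x_att_abs: "x_att F = (if s = 1 then x_plus A B C else x_minus A B C)"
  unfolding F_def using form by (subst x_att.abs_eq) auto

lemma x_rep_abs: "x_rep F = (if s = 1 then x_minus A B C else x_plus A B C)"
  unfolding F_def using form by (subst x_rep.abs_eq) auto

lemma psi2_eigen:
  assumes "M *v hom_coords z = a *s hom_coords z" "a \<noteq> 0"
  shows "act_p1r (psi2 F) z = z" "act_factor (psi2 F) z = \<bar>a\<bar>"
  using moebius_mat_eigen[OF assms]
  by (simp_all add: psi2_abs act_p1r.abs_eq act_factor.abs_eq det_psi2_matrix)

lemma x_att_fixed_abs: "act_p1r (psi2 F) (x_att F) = x_att F \<and> act_factor (psi2 F) (x_att F) > 1"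
proof -
  let ?a = "(t + s * sqrt (discr A B C)) / 2"
  have "M *v hom_coords (x_att F) = ?a *s hom_coords (x_att F)"
    unfolding x_att_abs M_def using form(2) hom_x_plus[OF form(1), of t] hom_x_minus[OF form(1), of t]
    by (elim disjE) simp_all
  moreover have "\<bar>?a\<bar> > 1" "?a \<noteq> 0"
    unfolding t_def using eigenvalue_bounds(1)[OF form] by linarith+
  ultimately show ?thesis using psi2_eigen by metis
qed

lemma x_rep_fixed_abs: "act_p1r (psi2 F) (x_rep F) = x_rep F \<and> act_factor (psi2 F) (x_rep F) < 1"
proof -
  let ?a = "(t - s * sqrt (discr A B C)) / 2"
  have "M *v hom_coords (x_rep F) = ?a *s hom_coords (x_rep F)"
    unfolding x_rep_abs M_def using form(2) hom_x_plus[OF form(1), of t] hom_x_minus[OF form(1), of t]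
    by (elim disjE) simp_all
  moreover have "\<bar>?a\<bar> < 1" "?a \<noteq> 0"
    unfolding t_def by (rule eigenvalue_bounds[OF form])+
  ultimately show ?thesis using psi2_eigen by metis
qed

end

lemma x_att_fixed: "act_p1r (psi2 F) (x_att F) = x_att F" "act_factor (psi2 F) (x_att F) > 1"
  by (cases F rule: poqf_cases; use x_att_fixed_abs in blast)+

lemma x_rep_fixed: "act_p1r (psi2 F) (x_rep F) = x_rep F" "act_factor (psi2 F) (x_rep F) < 1"
  by (cases F rule: poqf_cases; use x_rep_fixed_abs in blast)+

lemma x_att_unique:
  assumes "act_p1r (psi2 F) z = z" "act_factor (psi2 F) z > 1"
  shows "z = x_att F"
  using two_fixed_points[of "psi2 F" z "x_att F"] x_att_fixed[of F] assms
  by (metis less_1_mult less_irrefl)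

lemma x_rep_unique:
  assumes "act_p1r (psi2 F) z = z" "act_factor (psi2 F) z < 1"
  shows "z = x_rep F"
proof (rule ccontr)
  assume "z \<noteq> x_rep F"
  then have 1: "act_factor (psi2 F) z * act_factor (psi2 F) (x_rep F) = 1"
    using two_fixed_points[of "psi2 F" z "x_rep F"] x_rep_fixed[of F] assms by auto
  moreover have "act_factor (psi2 F) z \<ge> 0" by transfer auto
  ultimately show False using x_rep_fixed[of F] assms
    by (smt (verit) mult_left_le)
qed

text \<open>
  Being a fixed point with multiplier greater than \<open>1\<close> is invariant under conjugation and
  characterises the attracting zero; this avoids any computation with the transformed form.
\<close>

lemma x_att_act: "x_att (act_poqf g F) = act_p1r g (x_att F)"
  by (rule x_att_unique[symmetric])
    (use x_att_fixed[of F] in \<open>simp_all add: psi2_act act_factor_conj act_p1r_mult\<close>)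

lemma x_rep_act: "x_rep (act_poqf g F) = act_p1r g (x_rep F)"
  by (rule x_rep_unique[symmetric])
    (use x_rep_fixed[of F] in \<open>simp_all add: psi2_act act_factor_conj act_p1r_mult\<close>)

lemma psi2_inject [simp]: "psi2 F = psi2 G \<longleftrightarrow> F = G"
  by (metis psi2_inv_iff option.inject)

lemma psi2_surj: "g \<in> hyperbolic \<Longrightarrow> \<exists>F. psi2 F = g"
  using psi2_inv_eq_None_iff psi2_inv_iff by (metis not_None_eq)

lemma act_poqf_mult: "act_poqf (g * h) F = act_poqf g (act_poqf h F)"
  by (rule psi2_inject[THEN iffD1]) (simp add: psi2_act psl2r_inverse_mult mult.assoc)

lemma act_poqf_one [simp]: "act_poqf 1 F = F"
  by (rule psi2_inject[THEN iffD1]) (simp add: psi2_act)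

section \<open>Nonnegative matrices\<close>

lemma abs_psl2r_mult: "det M = 1 \<Longrightarrow> det N = 1 \<Longrightarrow> abs_psl2r M * abs_psl2r N = abs_psl2r (M ** N)"
  by (simp add: times_psl2r.abs_eq)

lemma abs_psl2r_eq_iff:
  assumes "det M = 1" "det N = 1"
  shows "abs_psl2r M = abs_psl2r N \<longleftrightarrow> N = M \<or> N = - M"
  using Quotient3_rel[OF Quotient3_psl2r, of M N] assms by auto

lemma one_psl2r_mat2: "1 = abs_psl2r (mat2 1 0 0 1)"
proof -
  have "mat 1 = mat2 1 0 0 1" by (simp add: vec_eq_iff forall_2 mat_def)
  then show ?thesis by (simp add: one_psl2r_def)
qed

lemma det_mat2: "det (mat2 a b c d) = a * d - b * c"
  by (simp add: det_2)

lemma mat2_mult: "mat2 a b c d ** mat2 a' b' c' d' =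
    mat2 (a * a' + b * c') (a * b' + b * d') (c * a' + d * c') (c * b' + d * d')"
  by (simp add: vec_eq_iff forall_2 matrix_matrix_mult_def sum_2)

lemma mat2_uminus: "- mat2 a b c d = mat2 (- a) (- b) (- c) (- d)"
  by (simp add: vec_eq_iff forall_2)

lemma mat2_eq_iff: "mat2 a b c d = mat2 a' b' c' d' \<longleftrightarrow> a = a' \<and> b = b' \<and> c = c' \<and> d = d'"
  by (auto simp: vec_eq_iff forall_2)

lemma act_p1r_mat2:
  assumes "a * d - b * c = 1"
  shows "act_p1r (abs_psl2r (mat2 a b c d)) (Fin x) =
      (if c * x + d = 0 then Infty else Fin ((a * x + b) / (c * x + d)))"
    "act_p1r (abs_psl2r (mat2 a b c d)) Infty = (if c = 0 then Infty else Fin (a / c))"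
  using assms by (simp_all add: act_p1r.abs_eq det_mat2)

lemma hyperbolic_mat2:
  assumes "a * d - b * c = 1"
  shows "abs_psl2r (mat2 a b c d) \<in> hyperbolic \<longleftrightarrow> \<bar>a + d\<bar> > 2"
  using assms by (simp add: hyperbolic_def abs_trace.abs_eq det_mat2 trace_def sum_2)

text \<open>
  Demanding diagonal entries \<open>\<ge> 1\<close>, and not just \<open>\<ge> 0\<close>, ensures that multiplication by a member
  of this monoid never decreases a matrix entry. So the trace does not decrease, and off-diagonal
  entries that are positive for one factor stay positive, which tells a product from the identity.
\<close>

definition nonneg_psl :: "psl2r set" where
  "nonneg_psl = {abs_psl2r (mat2 a b c d) | a b c d.
     a \<ge> 1 \<and> d \<ge> 1 \<and> b \<ge> 0 \<and> c \<ge> 0 \<and> a * d - b * c = 1}"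

lemma nonneg_pslE:
  assumes "g \<in> nonneg_psl"
  obtains a b c d where "g = abs_psl2r (mat2 a b c d)" "a \<ge> 1" "d \<ge> 1" "b \<ge> 0" "c \<ge> 0"
    "a * d - b * c = 1"
  using assms by (auto simp: nonneg_psl_def)

lemma one_nonneg_psl [simp]: "1 \<in> nonneg_psl"
  unfolding one_psl2r_mat2 nonneg_psl_def by fastforce

lemma nonneg_psl_mult_strict:
  assumes "a \<ge> 1" "d \<ge> 1" "b \<ge> 0" "c \<ge> 0" "a * d - b * c = 1" "h \<in> nonneg_psl"
  shows "\<exists>a' b' c' d'. abs_psl2r (mat2 a b c d) * h = abs_psl2r (mat2 a' b' c' d') \<and>
    a' \<ge> a \<and> d' \<ge> d \<and> b' \<ge> b \<and> c' \<ge> c \<and> a' * d' - b' * c' = 1"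
proof -
  obtain a' b' c' d' where h: "h = abs_psl2r (mat2 a' b' c' d')" "a' \<ge> 1" "d' \<ge> 1" "b' \<ge> 0" "c' \<ge> 0"
    "a' * d' - b' * c' = 1" using assms(6) by (elim nonneg_pslE)
  have "abs_psl2r (mat2 a b c d) * h =
      abs_psl2r (mat2 (a * a' + b * c') (a * b' + b * d') (c * a' + d * c') (c * b' + d * d'))"
    using assms h by (simp add: abs_psl2r_mult det_mat2 mat2_mult)
  moreover have "a * a' \<ge> a * 1" "d * d' \<ge> d * 1" "b * d' \<ge> b * 1" "c * a' \<ge> c * 1"
    using assms h by (intro mult_mono; simp)+
  moreover have "a * b' \<ge> 0" "b * c' \<ge> 0" "c * b' \<ge> 0" "d * c' \<ge> 0"
    using assms h by auto
  moreover have "(a * a' + b * c') * (c * b' + d * d') - (a * b' + b * d') * (c * a' + d * c') = 1"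
    using assms(5) h(6) by algebra
  ultimately show ?thesis by fastforce
qed

lemma nonneg_psl_mult:
  assumes "g \<in> nonneg_psl" "h \<in> nonneg_psl"
  shows "g * h \<in> nonneg_psl"
proof -
  obtain a b c d where g: "g = abs_psl2r (mat2 a b c d)" "a \<ge> 1" "d \<ge> 1" "b \<ge> 0" "c \<ge> 0"
    "a * d - b * c = 1" using assms(1) by (elim nonneg_pslE)
  obtain a' b' c' d' where gh: "g * h = abs_psl2r (mat2 a' b' c' d')"
    "a' \<ge> a" "d' \<ge> d" "b' \<ge> b" "c' \<ge> c" "a' * d' - b' * c' = 1"
    using nonneg_psl_mult_strict[OF g(2-) assms(2)] unfolding g(1) by blast
  then have "a' \<ge> 1" "d' \<ge> 1" "b' \<ge> 0" "c' \<ge> 0" using g by auto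
  with gh show ?thesis unfolding nonneg_psl_def by blast
qed

lemma act_nonneg_psl_pos:
  assumes "g \<in> nonneg_psl" "x > 0"
  shows "\<exists>y>0. act_p1r g (Fin x) = Fin y"
proof -
  obtain a b c d where g: "g = abs_psl2r (mat2 a b c d)" "a \<ge> 1" "d \<ge> 1" "b \<ge> 0" "c \<ge> 0"
    "a * d - b * c = 1" using assms(1) by (elim nonneg_pslE)
  have "c * x + d > 0" "a * x + b > 0" using g assms
    by (simp_all add: add_nonneg_pos add_pos_nonneg)
  then show ?thesis using g by (simp add: act_p1r_mat2)
qed

lemma hecke_S_mat2: "hecke_S = abs_psl2r (mat2 0 1 (- 1) 0)"
  by (simp add: hecke_S_def)

lemma hecke_S_square [simp]: "hecke_S * hecke_S = 1" "hecke_S * (hecke_S * g) = g"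
proof -
  show "hecke_S * hecke_S = 1"
    by (simp add: hecke_S_mat2 abs_psl2r_mult det_mat2 mat2_mult one_psl2r_mat2 abs_psl2r_eq_iff
        mat2_uminus)
  then show "hecke_S * (hecke_S * g) = g" by (simp flip: mult.assoc)
qed

lemma inverse_hecke_S [simp]: "inverse hecke_S = hecke_S"
  by (intro psl2r_inverse_unique) simp

lemma act_hecke_S: "act_p1r hecke_S (Fin x) = (if x = 0 then Infty else Fin (- 1 / x))"
  "act_p1r hecke_S Infty = Fin 0"
  by (auto simp: hecke_S_mat2 act_p1r_mat2 field_simps)

lemma act_hecke_S_neg: "y < 0 \<Longrightarrow> \<exists>x>0. act_p1r hecke_S (Fin y) = Fin x"
  by (simp add: act_hecke_S divide_neg_neg)

lemma act_hecke_S_pos: "x > 0 \<Longrightarrow> \<exists>y<0. act_p1r hecke_S (Fin x) = Fin y"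
  by (simp add: act_hecke_S)

text \<open>
  \<open>S\<close> exchanges the two half lines and \<open>v\<close> preserves the positive one, so a negative point is
  mapped to a positive one and cannot be fixed. The bounds on the diagonal of \<open>v\<close> exclude \<open>0\<close> and
  \<open>\<infinity>\<close>.
\<close>

lemma fixed_point_nonneg_mult_S:
  assumes "v \<in> nonneg_psl" "act_p1r (v * hecke_S) z = z"
  shows "\<exists>x>0. z = Fin x"
proof -
  obtain a b c d where v: "v = abs_psl2r (mat2 a b c d)" "a \<ge> 1" "d \<ge> 1" "b \<ge> 0" "c \<ge> 0"
    "a * d - b * c = 1" using assms(1) by (elim nonneg_pslE)
  show ?thesis
  proof (cases z)
    case Infty
    then show ?thesis using assms v by (simp add: act_p1r_mult act_hecke_S act_p1r_mat2)
  next
    case (Fin x)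
    consider "x > 0" | "x = 0" | "x < 0" by linarith
    then show ?thesis
    proof cases
      case 2
      then show ?thesis using assms v Fin
        by (auto simp: act_p1r_mult act_hecke_S act_p1r_mat2 split: if_splits)
    next
      case 3
      then have "- 1 / x > 0" by (simp add: divide_neg_neg)
      then obtain y where "y > 0" "act_p1r v (Fin (- 1 / x)) = Fin y"
        using act_nonneg_psl_pos assms(1) by blast
      then show ?thesis using assms Fin 3 by (simp add: act_p1r_mult act_hecke_S)
    qed (use Fin in auto)
  qed
qed

text \<open>
  The product of the two fixed points of the matrix with rows \<open>a, b\<close> and \<open>c, d\<close> is \<open>- b / c\<close>, so
  they have opposite signs as soon as \<open>b\<close> and \<open>c\<close> are positive. If one of these vanished, the
  diagonal would have product \<open>1\<close>, and the matrix would not be hyperbolic.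
\<close>

lemma nonneg_hyperbolic_fixed_points:
  assumes "psi2 F \<in> nonneg_psl"
  shows "\<exists>x>0. x_att F = Fin x" "\<exists>y<0. x_rep F = Fin y" "reduced F"
proof -
  obtain a b c d where v: "psi2 F = abs_psl2r (mat2 a b c d)" "a \<ge> 1" "d \<ge> 1" "b \<ge> 0" "c \<ge> 0"
    "a * d - b * c = 1" using assms(1) by (elim nonneg_pslE)
  have tr: "a + d > 2" using psi2_hyperbolic[of F] v by (simp add: hyperbolic_mat2)
  \<comment> \<open>A triangular matrix in the monoid is unipotent, hence not hyperbolic.\<close>
  have "b * c \<noteq> 0"
  proof
    assume "b * c = 0"
    then have "a * d = 1" using v(6) by linarith
    moreover have "(a - 1) * (d - 1) \<ge> 0" using v by simp
    ultimately show False using tr by (simp add: algebra_simps)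
  qed
  then have bc: "b > 0" "c > 0" using v by auto
  \<comment> \<open>The form attached to a matrix of positive trace is \<open>[c, d - a, - b, +1]\<close>.\<close>
  define D where "D = discr c (d - a) (- b)"
  have D: "D = (d - a)\<^sup>2 + 4 * (b * c)" by (simp add: D_def discr_def)
  have "b * c > 0" using bc by simp
  then have D0: "D > 0" "(d - a)\<^sup>2 < D" unfolding D by (simp_all add: add_nonneg_pos)
  have "sqrt ((d - a)\<^sup>2) < sqrt D" using D0 by (simp only: real_sqrt_less_mono)
  then have r: "\<bar>d - a\<bar> < sqrt D" by simp
  have "D + 4 = (a + d)\<^sup>2" using v unfolding D by (simp add: power2_eq_square algebra_simps)
  then have "sqrt (D + 4) = a + d" using v by simp
  moreover have "(a - d + (a + d)) / 2 = a" "(d - a + (a + d)) / 2 = d" by simp_all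
  ultimately have "psi2 (abs_poqf (c, d - a, - b, 1)) = psi2 F"
    using v D0 by (subst psi2.abs_eq) (simp_all add: D_def)
  then have F: "F = abs_poqf (c, d - a, - b, 1)" by simp
  have "x_att F = Fin ((- (d - a) + sqrt D) / (2 * c))" "x_rep F = Fin ((- (d - a) - sqrt D) / (2 * c))"
    unfolding F using D0 bc
    by (simp_all add: x_att.abs_eq x_rep.abs_eq x_plus_def x_minus_def D_def)
  moreover have "(- (d - a) + sqrt D) / (2 * c) > 0" "(- (d - a) - sqrt D) / (2 * c) < 0"
    using r bc by (auto intro!: divide_pos_pos divide_neg_pos)
  ultimately show "\<exists>x>0. x_att F = Fin x" "\<exists>y<0. x_rep F = Fin y" "reduced F"
    by (auto simp: reduced_def)
qed

lemma unipotent_power: "abs_psl2r (mat2 1 b 0 1) ^ n = abs_psl2r (mat2 1 (real n * b) 0 1)"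
  "abs_psl2r (mat2 1 0 c 1) ^ n = abs_psl2r (mat2 1 0 (real n * c) 1)"
  by (induction n) (simp_all add: one_psl2r_mat2 abs_psl2r_mult det_mat2 mat2_mult algebra_simps)

text \<open>A nonhyperbolic member is unipotent and triangular, and so are its powers.\<close>

lemma nonneg_psl_hyperbolic_root:
  assumes "g \<in> nonneg_psl" "g ^ n \<in> hyperbolic"
  shows "g \<in> hyperbolic"
proof (rule ccontr)
  assume nh: "g \<notin> hyperbolic"
  obtain a b c d where v: "g = abs_psl2r (mat2 a b c d)" "a \<ge> 1" "d \<ge> 1" "b \<ge> 0" "c \<ge> 0"
    "a * d - b * c = 1" using assms(1) by (elim nonneg_pslE)
  have "a + d \<le> 2" using nh v by (simp add: hyperbolic_mat2)
  then have "a = 1" "d = 1" using v by auto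
  with v have "b = 0 \<or> c = 0" by auto
  then show False
    using assms(2) unfolding v(1) \<open>a = 1\<close> \<open>d = 1\<close>
    by (elim disjE) (simp_all add: unipotent_power hyperbolic_mat2)
qed

lemma nonneg_psl_power: "g \<in> nonneg_psl \<Longrightarrow> g ^ n \<in> nonneg_psl"
  by (induction n) (simp_all add: nonneg_psl_mult)

lemma nonneg_psl_hyperbolic_mult:
  assumes "g \<in> nonneg_psl" "g \<in> hyperbolic" "h \<in> nonneg_psl"
  shows "g * h \<in> hyperbolic"
proof -
  obtain a b c d where v: "g = abs_psl2r (mat2 a b c d)" "a \<ge> 1" "d \<ge> 1" "b \<ge> 0" "c \<ge> 0"
    "a * d - b * c = 1" using assms(1) by (elim nonneg_pslE)
  obtain a' b' c' d' where v': "g * h = abs_psl2r (mat2 a' b' c' d')" "a' \<ge> a" "d' \<ge> d"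
    "a' * d' - b' * c' = 1"
    using nonneg_psl_mult_strict[OF v(2-) assms(3)] unfolding v(1) by blast
  show ?thesis
    using assms(2) v v' by (simp add: hyperbolic_mat2)
qed

section \<open>Words in the generators\<close>

definition hecke_V :: "nat \<Rightarrow> nat \<Rightarrow> psl2r" where
  "hecke_V q k = hecke_U q ^ k * hecke_S"

definition word_psl :: "nat \<Rightarrow> nat list \<Rightarrow> psl2r" where
  "word_psl q w = prod_list (map (hecke_V q) w)"

lemma word_psl_simps [simp]:
  "word_psl q [] = 1" "word_psl q (k # w) = hecke_V q k * word_psl q w"
  "word_psl q (u @ w) = word_psl q u * word_psl q w"
  by (simp_all add: word_psl_def)

lemma word_psl_power: "word_psl q (concat (replicate n u)) = word_psl q u ^ n"
  by (induction n) simp_all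

lemma inverse_hecke_g [simp]: "inverse (hecke_g q (int k)) = hecke_V q k"
  by (simp add: hecke_g_def hecke_V_def)

text \<open>Natural numbers suffice as letters, since only \<open>1 \<le> k \<le> q - 1\<close> occurs as interval number.\<close>

lemma hecke_g_eq: "hecke_g q (int k) = inverse (hecke_V q k)"
  by (simp add: hecke_g_def hecke_V_def)

definition letters :: "nat \<Rightarrow> nat set" where
  "letters q = {1..q - 1}"

text \<open>
  At integers these are the values of the Chebyshev polynomials of the second kind at
  \<open>cos (pi / q)\<close>. They are the entries of the powers of \<open>U\<close>. The index is real so that it can be
  negative.
\<close>

definition hsin :: "nat \<Rightarrow> real \<Rightarrow> real" where
  "hsin q x = sin (x * pi / q) / sin (pi / q)"

context
  fixes q :: nat
  assumes q3: "q \<ge> 3"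
begin

lemma sin_pi_q_pos: "sin (pi / q) > 0"
  using q3 by (intro sin_gt_zero) (auto simp: field_simps)

lemma hsin_simps [simp]:
  "hsin q 0 = 0" "hsin q 1 = 1" "hsin q (- 1) = - 1"
  using sin_pi_q_pos by (simp_all add: hsin_def)

lemma hsin_reflect: "hsin q (real q - x) = hsin q x"
proof -
  have "(real q - x) * pi / q = pi - x * pi / q" using q3 by (simp add: field_simps)
  then show ?thesis by (simp add: hsin_def)
qed

lemma hsin_recurrence: "hsin q (x + 1) = hecke_lambda q * hsin q x - hsin q (x - 1)"
proof -
  have 1: "(x + 1) * pi / q = x * pi / q + pi / q" "(x - 1) * pi / q = x * pi / q - pi / q"
    by (simp_all add: ring_distribs add_divide_distrib diff_divide_distrib)
  show ?thesis
    unfolding hsin_def hecke_lambda_def 1 sin_add sin_diff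
    using sin_pi_q_pos by (simp add: field_simps)
qed

text \<open>
  A form of Ptolemy's theorem. The case \<open>x = y\<close> says that \<open>V\<^sub>k\<close> has determinant \<open>1\<close>; the case
  \<open>x < y\<close> says that the intervals \<open>V\<^sub>k (0, \<infinity>)\<close> are arranged in decreasing order.
\<close>

lemma hsin_ptolemy: "hsin q (x + 1) * hsin q (y - 1) = hsin q x * hsin q y + hsin q (y - x - 1)"
proof -
  define t a b where "t = pi / q" and "a = x * pi / q" and "b = y * pi / q"
  have 1: "(x + 1) * pi / q = a + t" "(y - 1) * pi / q = b - t" "(y - x - 1) * pi / q = (b - a) - t"
    by (simp_all add: a_def b_def t_def ring_distribs add_divide_distrib diff_divide_distrib)
  have "sin (a + t) * sin (b - t) = sin a * sin b + sin (b - a - t) * sin t"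
    using sin_cos_squared_add[of t] unfolding sin_add sin_diff cos_diff cos_add by algebra
  moreover have "sin t > 0" unfolding t_def by (rule sin_pi_q_pos)
  moreover have "hsin q x = sin a / sin t" "hsin q y = sin b / sin t"
    by (simp_all add: hsin_def a_def b_def t_def)
  moreover have "hsin q (x + 1) = sin (a + t) / sin t" "hsin q (y - 1) = sin (b - t) / sin t"
    "hsin q (y - x - 1) = sin (b - a - t) / sin t"
    unfolding hsin_def 1 t_def by simp_all
  moreover have "m / s * (n / s) = k / s * (l / s) + r / s"
    if "m * n = k * l + r * s" "s > 0" for m n k l r s :: real
    using that by (simp add: field_simps)
  ultimately show ?thesis by presburger
qed

lemma hsin_nonneg: "0 \<le> x \<Longrightarrow> x \<le> real q \<Longrightarrow> hsin q x \<ge> 0"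
  unfolding hsin_def using sin_pi_q_pos q3
  by (intro divide_nonneg_pos sin_ge_zero) (auto simp: field_simps)

lemma hsin_ge_1:
  assumes "1 \<le> x" "x \<le> real q - 1"
  shows "hsin q x \<ge> 1"
proof -
  have "sin (x * pi / q) - sin (pi / q) =
      2 * sin ((x * pi / q - pi / q) / 2) * cos ((x * pi / q + pi / q) / 2)"
    by (rule sin_diff_sin)
  also have "(x * pi / q - pi / q) / 2 = (x - 1) * pi / (2 * q)"
    using q3 by (simp add: field_simps)
  also have "(x * pi / q + pi / q) / 2 = (x + 1) * pi / (2 * q)"
    using q3 by (simp add: field_simps)
  also have "2 * sin ((x - 1) * pi / (2 * q)) * cos ((x + 1) * pi / (2 * q)) \<ge> 0"
  proof -
    have "0 \<le> (x - 1) * pi / (2 * q)" "(x - 1) * pi / (2 * q) \<le> pi"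
      "- pi / 2 \<le> (x + 1) * pi / (2 * q)" "(x + 1) * pi / (2 * q) \<le> pi / 2"
    proof -
      have "(x + 1) / real q \<le> 1" "(x - 1) / real q \<le> 1" "(x - 1) / real q \<ge> 0"
        using assms q3 by auto
      note * = this[THEN mult_right_mono, of "pi / 2"]
      show "0 \<le> (x - 1) * pi / (2 * q)" using assms by simp
      show "(x - 1) * pi / (2 * q) \<le> pi" "(x + 1) * pi / (2 * q) \<le> pi / 2"
        using * pi_gt_zero by (simp_all add: mult.commute)
      have "(x + 1) * pi / (2 * q) \<ge> 0" using assms by simp
      then show "- pi / 2 \<le> (x + 1) * pi / (2 * q)" using pi_gt_zero by linarith
    qed
    then show ?thesis by (intro mult_nonneg_nonneg sin_ge_zero cos_ge_zero) auto
  qed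
  finally show ?thesis using sin_pi_q_pos by (simp add: hsin_def field_simps)
qed

lemma hecke_U_mat2: "hecke_U q = abs_psl2r (mat2 (hecke_lambda q) (- 1) 1 0)"
  by (simp add: hecke_U_def hecke_T_def hecke_S_mat2 abs_psl2r_mult det_mat2 mat2_mult
      abs_psl2r_eq_iff mat2_uminus)

lemma det_hecke_V: "hsin q x * hsin q x - hsin q (x + 1) * hsin q (x - 1) = 1"
  using hsin_ptolemy[of x x] by simp

lemma hecke_V_mat2: "hecke_V q k =
    abs_psl2r (mat2 (hsin q k) (hsin q (real k + 1)) (hsin q (real k - 1)) (hsin q k))"
proof (induction k)
  case (Suc k)
  have V: "hecke_V q (Suc k) = hecke_U q * hecke_V q k"
    by (simp add: hecke_V_def mult.assoc)
  have r: "hsin q (real k + 2) = hecke_lambda q * hsin q (real k + 1) - hsin q k"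
    "hecke_lambda q * hsin q k - hsin q (real k - 1) = hsin q (real k + 1)"
    using hsin_recurrence[of "real k + 1"] hsin_recurrence[of k] by (simp_all add: add.assoc)
  show ?case
    unfolding V Suc hecke_U_mat2 using det_hecke_V[of k] r
    by (simp add: abs_psl2r_mult det_mat2 mat2_mult add_ac)
next
  case 0
  then show ?case
    by (simp add: hecke_V_def hecke_S_mat2)
qed

lemma hecke_U_power_q [simp]: "hecke_U q ^ q = 1"
proof -
  have "hsin q (real q + 1) = - 1" "hsin q (real q - 1) = 1" "hsin q q = 0"
    using hsin_reflect[of "-1"] hsin_reflect[of 1] hsin_reflect[of 0] by (simp_all add: add.commute)
  \<comment> \<open>The formula for \<open>V\<^sub>q\<close> has the rows \<open>0, -1\<close> and \<open>1, 0\<close>.\<close>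
  then have "hecke_V q q = hecke_S"
    by (simp add: hecke_V_mat2 hecke_S_mat2 abs_psl2r_eq_iff det_mat2 mat2_uminus)
  then have "hecke_U q ^ q * hecke_S = 1 * hecke_S" by (simp add: hecke_V_def)
  then show ?thesis by (simp only: psl2r_mult_right_cancel)
qed

lemma letter_bounds:
  assumes "k \<in> letters q"
  shows "hsin q k \<ge> 1" "hsin q (real k + 1) \<ge> 0" "hsin q (real k - 1) \<ge> 0"
    "hsin q (real k + 1) + hsin q (real k - 1) > 0"
proof -
  have k: "1 \<le> real k" "real k \<le> real q - 1" "real k \<le> q"
    using assms by (auto simp: letters_def)
  show 1: "hsin q k \<ge> 1" "hsin q (real k + 1) \<ge> 0" "hsin q (real k - 1) \<ge> 0"
    using k by (auto intro!: hsin_ge_1 hsin_nonneg)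
  have "pi / q < pi / 2" using q3 by (simp add: field_simps)
  then have "hecke_lambda q > 0" unfolding hecke_lambda_def using q3
    by (auto intro!: cos_gt_zero)
  then have "hecke_lambda q * hsin q k > 0" using 1 by auto
  then show "hsin q (real k + 1) + hsin q (real k - 1) > 0" using hsin_recurrence[of k]
    by (simp add: add.commute)
qed

lemma hecke_V_nonneg [simp]: "k \<in> letters q \<Longrightarrow> hecke_V q k \<in> nonneg_psl"
  using letter_bounds[of k] det_hecke_V[of k] unfolding hecke_V_mat2 nonneg_psl_def
  by (auto simp: add.commute)

lemma word_psl_nonneg [simp]: "set w \<subseteq> letters q \<Longrightarrow> word_psl q w \<in> nonneg_psl"
  by (induction w) (auto intro: nonneg_psl_mult)

text \<open>
  The entries of the product dominate those of the first letter, whose two off-diagonal entries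
  have positive sum.
\<close>

lemma word_psl_eq_1_iff:
  assumes "set w \<subseteq> letters q"
  shows "word_psl q w = 1 \<longleftrightarrow> w = []"
proof (cases w)
  case (Cons k u)
  note b = letter_bounds[of k]
  have k: "k \<in> letters q" "word_psl q u \<in> nonneg_psl" using Cons assms by auto
  obtain a b c d where v: "word_psl q w = abs_psl2r (mat2 a b c d)" "b \<ge> hsin q (real k + 1)"
    "c \<ge> hsin q (real k - 1)" "a * d - b * c = 1"
    using nonneg_psl_mult_strict[OF b(1,1,2,3) _ k(2)] k det_hecke_V[of k]
    by (auto simp: hecke_V_mat2 Cons add.commute)
  have "abs_psl2r (mat2 a b c d) \<noteq> 1"
    using v b[OF k(1)]
    by (auto simp: one_psl2r_mat2 abs_psl2r_eq_iff det_mat2 mat2_uminus mat2_eq_iff)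
  then show ?thesis using v Cons by simp
qed simp

lemma in_V_interval_iff:
  assumes "k \<in> letters q"
  shows "z \<in> {act_p1r (hecke_V q k) (Fin 0) <..< act_p1r (hecke_V q k) Infty} \<longleftrightarrow>
    (\<exists>y. z = Fin y \<and> hsin q (real k + 1) < y * hsin q k \<and> y * hsin q (real k - 1) < hsin q k)"
  using letter_bounds[OF assms] det_hecke_V[of k]
  by (cases z) (auto simp: hecke_V_mat2 act_p1r_mat2 pos_divide_less_eq pos_less_divide_eq add.commute)

text \<open>
  The two hypotheses on \<open>y\<close> say that it lies above the left endpoint of the interval of \<open>k\<close> and
  below the right endpoint of the interval of \<open>l\<close>. For \<open>k < l\<close> this contradicts the decreasing
  order of the intervals.
\<close>

lemma V_intervals_disjoint:
  assumes "k \<in> letters q" "l \<in> letters q" "k < l"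
    "hsin q (real k + 1) < y * hsin q k" "y * hsin q (real l - 1) < hsin q l"
  shows False
proof -
  note k = letter_bounds[OF assms(1)]
  have "hsin q (real l - 1) \<ge> 1"
    using assms by (intro hsin_ge_1) (auto simp: letters_def)
  then have "hsin q (real k + 1) * hsin q (real l - 1) < y * hsin q k * hsin q (real l - 1)"
    using assms(4) by (intro mult_strict_right_mono) auto
  also have "\<dots> = hsin q k * (y * hsin q (real l - 1))" by simp
  also have "\<dots> < hsin q k * hsin q l"
    using assms(5) k by (intro mult_strict_left_mono) auto
  also have "\<dots> \<le> hsin q (real k + 1) * hsin q (real l - 1)"
    using hsin_ptolemy[of k l] hsin_nonneg[of "real l - real k - 1"] assms
    by (auto simp: letters_def add.commute)
  finally show False by simp
qed

text \<open>
  The definite description in \<open>interval\<close> is harmless here: the number \<open>k\<close> qualifies because \<open>V\<^sub>k\<close> is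
  increasing, and it is the only one because the intervals are disjoint.
\<close>

lemma interval_act_V:
  assumes "k \<in> letters q" "x > 0"
  shows "interval q (act_p1r (hecke_V q k) (Fin x)) = Some (int k)"
proof -
  let ?z = "act_p1r (hecke_V q k) (Fin x)"
  define P where "P = (\<lambda>k. k \<in> {1..int q - 1} \<and>
      ?z \<in> {act_p1r (inverse (hecke_g q k)) (Fin 0) <..< act_p1r (inverse (hecke_g q k)) Infty})"
  have P_iff: "P j \<longleftrightarrow> (\<exists>i\<in>letters q. j = int i \<and>
      (\<exists>y. ?z = Fin y \<and> hsin q (real i + 1) < y * hsin q i \<and> y * hsin q (real i - 1) < hsin q i))" for j
  proof (cases "j \<in> {1..int q - 1}")
    case True
    then obtain i where i: "j = int i" by (metis atLeastAtMost_iff int_one_le_iff_zero_less zero_less_imp_eq_int)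
    with True have "i \<in> letters q" by (auto simp: letters_def)
    note in_V_interval_iff[OF this, of ?z]
    with i True \<open>i \<in> letters q\<close> show ?thesis unfolding P_def i inverse_hecke_g by auto
  next
    case False
    then show ?thesis by (auto simp: P_def letters_def)
  qed
  note b = letter_bounds[OF assms(1)]
  define n m where "n = hsin q k * x + hsin q (real k + 1)" and "m = hsin q (real k - 1) * x + hsin q k"
  have m: "m > 0" using b assms unfolding m_def by (intro add_nonneg_pos) auto
  have z: "?z = Fin (n / m)"
    using m det_hecke_V[of k] by (simp add: hecke_V_mat2 act_p1r_mat2 n_def m_def add.commute)
  have "n * hsin q k - hsin q (real k + 1) * m = x" "hsin q k * m - n * hsin q (real k - 1) = 1"
    using det_hecke_V[of k] unfolding n_def m_def by algebra+
  then have "hsin q (real k + 1) < n / m * hsin q k" "n / m * hsin q (real k - 1) < hsin q k"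
    using m assms by (simp_all add: pos_less_divide_eq pos_divide_less_eq)
  then have Pk: "P (int k)" unfolding P_iff z using assms by blast
  moreover have "j = int k" if "P j" for j
    using that Pk V_intervals_disjoint unfolding P_iff by (metis nat_neq_iff p1r.inject of_nat_eq_iff)
  ultimately have "\<exists>!k. P k" "(THE k. P k) = int k" by blast+
  then show ?thesis unfolding interval_def P_def[symmetric] Let_def by simp
qed

text \<open>
  The interval number of the image is the first letter. Removing the first letter from both words, one
  reads them off letter by letter. Applied to a common fixed point \<open>x = y\<close>, this recovers a word
  from its attracting fixed point and its length.
\<close>

lemma word_psl_prefix_unique:
  assumes "set u \<subseteq> letters q" "set w \<subseteq> letters q" "length u = length w" "x > 0" "y > 0"
    "act_p1r (word_psl q u) (Fin x) = act_p1r (word_psl q w) (Fin y)"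
  shows "u = w \<and> x = y"
  using assms(3,1,2,6)
proof (induction u w rule: list_induct2)
  case (Cons k u l w)
  obtain x' where x': "x' > 0" "act_p1r (word_psl q u) (Fin x) = Fin x'"
    using act_nonneg_psl_pos[of "word_psl q u" x] Cons.prems assms(4) by auto
  obtain y' where y': "y' > 0" "act_p1r (word_psl q w) (Fin y) = Fin y'"
    using act_nonneg_psl_pos[of "word_psl q w" y] Cons.prems assms(5) by auto
  have eq: "act_p1r (hecke_V q k) (Fin x') = act_p1r (hecke_V q l) (Fin y')"
    using Cons.prems(3) x' y' by (simp add: act_p1r_mult)
  then have "k = l"
    using interval_act_V[of k x'] interval_act_V[of l y'] x' y' Cons by simp
  moreover from this eq have "Fin x' = Fin y'" by (metis act_p1r_inverse(1))
  ultimately show ?case using Cons x' y' by simp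
qed simp

text \<open>The shorter word is a prefix of the longer one, and the rest represents the identity.\<close>

lemma word_psl_inj_le:
  assumes "set u \<subseteq> letters q" "set w \<subseteq> letters q" "length u \<le> length w" "word_psl q u = word_psl q w"
  shows "u = w"
proof -
  define w1 w2 where "w1 = take (length u) w" and "w2 = drop (length u) w"
  have w: "w = w1 @ w2" "length u = length w1" "set w1 \<subseteq> letters q" "set w2 \<subseteq> letters q"
    using assms by (auto simp: w1_def w2_def dest: in_set_takeD in_set_dropD)
  obtain y where y: "y > 0" "act_p1r (word_psl q w2) (Fin 1) = Fin y"
    using act_nonneg_psl_pos[of "word_psl q w2" 1] w by auto
  have "u = w1"
    using word_psl_prefix_unique[of u w1 1 y] assms w y by (simp add: act_p1r_mult)
  then have "word_psl q w2 = 1"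
    using assms(4) w(1) by (metis mult_1_right psl2r_mult_left_cancel word_psl_simps(3))
  then show ?thesis using word_psl_eq_1_iff w \<open>u = w1\<close> by simp
qed

lemma word_psl_inj:
  assumes "set u \<subseteq> letters q" "set w \<subseteq> letters q"
  shows "word_psl q u = word_psl q w \<longleftrightarrow> u = w"
  using word_psl_inj_le[of u w] word_psl_inj_le[of w u] assms by (metis nat_le_linear)

lemma inverse_hecke_V:
  assumes "k \<in> letters q"
  shows "inverse (hecke_V q k) = hecke_S * hecke_V q (q - k) * hecke_S"
proof (rule psl2r_inverse_unique)
  have "hecke_V q k * (hecke_S * hecke_V q (q - k) * hecke_S) = hecke_U q ^ (k + (q - k))"
    by (simp add: hecke_V_def mult.assoc power_add)
  also have "k + (q - k) = q" using assms by (auto simp: letters_def)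
  finally show "hecke_V q k * (hecke_S * hecke_V q (q - k) * hecke_S) = 1" by simp
qed

text \<open>Letter by letter, \<open>V\<^sub>k\<^sup>-\<^sup>1 = S U\<^sup>-\<^sup>k = S V\<^bsub>q-k\<^esub> S\<close>, and the inner factors \<open>S S\<close> cancel.\<close>

lemma inverse_word_psl:
  assumes "set w \<subseteq> letters q"
  obtains w' where "set w' \<subseteq> letters q" "inverse (word_psl q w) = hecke_S * word_psl q w' * hecke_S"
proof -
  have "\<exists>w'. set w' \<subseteq> letters q \<and> inverse (word_psl q w) = hecke_S * word_psl q w' * hecke_S"
    using assms
  proof (induction w)
    case (Cons k w)
    then obtain w' where w': "set w' \<subseteq> letters q" "inverse (word_psl q w) = hecke_S * word_psl q w' * hecke_S"
      by auto
    have "set (w' @ [q - k]) \<subseteq> letters q" using Cons w' by (auto simp: letters_def)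
    moreover have "inverse (word_psl q (k # w)) = hecke_S * word_psl q (w' @ [q - k]) * hecke_S"
      using Cons w' by (simp add: psl2r_inverse_mult inverse_hecke_V mult.assoc)
    ultimately show ?case by blast
  qed (auto intro!: exI[of _ "[]"])
  with that show ?thesis by blast
qed

definition S_words :: "psl2r set" where
  "S_words = {s * word_psl q w * t | s t w. s \<in> {1, hecke_S} \<and> t \<in> {1, hecke_S} \<and> set w \<subseteq> letters q}"

lemma S_wordsI: "set w \<subseteq> letters q \<Longrightarrow> t \<in> {1, hecke_S} \<Longrightarrow> word_psl q w * t \<in> S_words"
  "set w \<subseteq> letters q \<Longrightarrow> t \<in> {1, hecke_S} \<Longrightarrow> hecke_S * word_psl q w * t \<in> S_words"
proof -
  have *: "s * word_psl q w * t \<in> S_words"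
    if "set w \<subseteq> letters q" "t \<in> {1, hecke_S}" "s \<in> {1, hecke_S}" for s w t
    using that unfolding S_words_def by blast
  show "set w \<subseteq> letters q \<Longrightarrow> t \<in> {1, hecke_S} \<Longrightarrow> word_psl q w * t \<in> S_words"
    "set w \<subseteq> letters q \<Longrightarrow> t \<in> {1, hecke_S} \<Longrightarrow> hecke_S * word_psl q w * t \<in> S_words"
    using *[of w t 1] *[of w t hecke_S] by simp_all
qed

lemma S_wordsE:
  assumes "g \<in> S_words"
  obtains s t w where "s \<in> {1, hecke_S}" "t \<in> {1, hecke_S}" "set w \<subseteq> letters q" "g = s * word_psl q w * t"
  using assms unfolding S_words_def by blast

lemma S_words_mult_S: "g \<in> S_words \<Longrightarrow> hecke_S * g \<in> S_words"
  using S_wordsI unfolding S_words_def by (force simp: mult.assoc)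

text \<open>
  Left multiplication by \<open>U\<close> raises the first letter by \<open>1\<close>, turning it into \<open>S\<close> if it was
  \<open>q - 1\<close>, or creates a letter \<open>1\<close> in front.
\<close>

lemma S_words_mult_U:
  assumes "g \<in> S_words"
  shows "hecke_U q * g \<in> S_words"
proof -
  obtain s w t where g: "s \<in> {1, hecke_S}" "t \<in> {1, hecke_S}" "set w \<subseteq> letters q"
    "g = s * word_psl q w * t" using assms unfolding S_words_def by blast
  have 1: "1 \<in> letters q" using q3 by (auto simp: letters_def)
  have V1: "hecke_U q * hecke_S * h = hecke_V q 1 * h" for h by (simp add: hecke_V_def)
  show ?thesis
  proof (cases "s = hecke_S")
    case True
    then have "hecke_U q * g = word_psl q (1 # w) * t" using g by (simp add: hecke_V_def mult.assoc)
    then show ?thesis using g 1 S_wordsI(1)[of "1 # w" t] by simp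
  next
    case False
    then have g': "g = word_psl q w * t" using g by simp
    show ?thesis
    proof (cases w)
      case Nil
      have "hecke_U q * g = hecke_V q 1 * (hecke_S * t)" using g' Nil by (simp add: hecke_V_def mult.assoc)
      moreover have "hecke_S * t \<in> {1, hecke_S}" using g by auto
      ultimately show ?thesis using 1 S_wordsI(1)[of "[1]" "hecke_S * t"] by simp
    next
      case (Cons k u)
      have *: "hecke_U q * g = hecke_V q (Suc k) * word_psl q u * t" using g' Cons
        by (simp add: hecke_V_def mult.assoc)
      show ?thesis
      proof (cases "Suc k = q")
        case True
        then have "hecke_V q (Suc k) = hecke_S" unfolding hecke_V_def by simp
        with * show ?thesis using Cons g S_wordsI(2)[of u t] by simp
      next
        case False
        then have "Suc k \<in> letters q" using Cons g by (auto simp: letters_def)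
        then show ?thesis using * Cons g S_wordsI(1)[of "Suc k # u" t] by simp
      qed
    qed
  qed
qed

text \<open>
  The elements that preserve the set under left multiplication form a group containing the
  generators \<open>S\<close> and \<open>T = U S\<close>. The inverse of \<open>U\<close> is one of its powers.
\<close>

lemma hecke_group_S_words:
  assumes "g \<in> hecke_group q"
  shows "g \<in> S_words"
proof -
  have *: "g ^ n * h \<in> S_words" if "\<And>h. h \<in> S_words \<Longrightarrow> g * h \<in> S_words" "h \<in> S_words" for g h n
    using that by (induction n) (auto simp: mult.assoc)
  have T: "hecke_T q = hecke_U q * hecke_S" by (simp add: hecke_U_def mult.assoc)
  have "hecke_U q ^ Suc (q - 1) = 1" using q3 by simp
  then have U: "inverse (hecke_U q) = hecke_U q ^ (q - 1)"
    by (intro psl2r_inverse_unique) (simp only: power_Suc)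
  have "\<forall>h\<in>S_words. g * h \<in> S_words \<and> inverse g * h \<in> S_words"
    using assms
    by (induction rule: hecke_group.induct)
       (auto simp: T S_words_mult_S S_words_mult_U psl2r_inverse_mult mult.assoc U *)
  moreover have "1 \<in> S_words" using S_wordsI(1)[of "[]" 1] by simp
  ultimately show ?thesis by force
qed

lemma hecke_groupE:
  assumes "g \<in> hecke_group q"
  obtains w where "set w \<subseteq> letters q" "g = word_psl q w"
  | w where "set w \<subseteq> letters q" "g = word_psl q w * hecke_S"
  | w where "set w \<subseteq> letters q" "g = hecke_S * word_psl q w"
  | w where "set w \<subseteq> letters q" "g = hecke_S * word_psl q w * hecke_S"
proof -
  obtain s w t where "s \<in> {1, hecke_S}" "t \<in> {1, hecke_S}" "set w \<subseteq> letters q"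
    "g = s * word_psl q w * t" using hecke_group_S_words[OF assms] unfolding S_words_def by blast
  with that show ?thesis by auto
qed

end

section \<open>Conjugate words and periods of words\<close>

text \<open>
  The Lyndon--Schuetzenberger description of conjugacy: for nonempty \<open>u\<close>, cancelling copies of \<open>u\<close>
  from the left of \<open>v\<close>, one may assume that \<open>v\<close> is a prefix of \<open>u\<close>.
\<close>

lemma conjugate_words_rotate:
  assumes "u @ v = v @ w"
  shows "\<exists>i. rotate i u = w" "\<exists>i. rotate i w = u"
proof -
  have "(\<exists>i. rotate i u = w) \<and> (\<exists>i. rotate i w = u)"
    using assms
  proof (induction "length v" arbitrary: v rule: less_induct)
    case less
    show ?case
    proof (cases "u = []")
      case True
      then show ?thesis using less by simp
    next
      case False
      from less.prems obtain z where "u = v @ z \<and> z @ v = w \<or> u @ z = v \<and> v = z @ w"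
        unfolding append_eq_append_conv2 by blast
      then consider "u = v @ z" "z @ v = w" | "v = u @ z" "v = z @ w"
        by metis
      then show ?thesis
      proof cases
        case 1
        then show ?thesis by (metis rotate_append)
      next
        case 2
        then have "length z < length v" "u @ z = z @ w" using False by (metis length_greater_0_conv length_append less_add_same_cancel2, metis)
        then show ?thesis using less.hyps by blast
      qed
    qed
  qed
  then show "\<exists>i. rotate i u = w" "\<exists>i. rotate i w = u" by auto
qed

lemma commuting_words_power:
  assumes "u @ v = v @ u" "length v = m * length u"
  shows "v = concat (replicate m u)"
  using assms
proof (induction m arbitrary: v)
  case (Suc m)
  then have "length u \<le> length v" by simp
  then obtain z where z: "v = u @ z" using Suc.prems(1)
    by (metis append_eq_append_conv_if append_take_drop_id)
  then have "z = concat (replicate m u)" using Suc by simp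
  then show ?case using z by simp
qed simp

lemma concat_replicate_append: "concat (replicate n u) @ u = u @ concat (replicate n u)"
  by (induction n) simp_all

lemma inj_rotate: "inj (rotate n)"
  unfolding rotate_def by (intro inj_fn inj_rotate1)

definition min_period :: "'a list \<Rightarrow> nat" where
  "min_period w = (LEAST p. p > 0 \<and> rotate p w = w)"

lemma min_period:
  assumes "w \<noteq> []"
  shows "min_period w > 0" "rotate (min_period w) w = w" "min_period w \<le> length w"
proof -
  have *: "length w > 0 \<and> rotate (length w) w = w" using assms by simp
  then show "min_period w > 0" "rotate (min_period w) w = w"
    unfolding min_period_def by (metis (mono_tags, lifting) LeastI)+
  show "min_period w \<le> length w" unfolding min_period_def using * by (rule Least_le)
qed

lemma min_period_le: "j > 0 \<Longrightarrow> rotate j w = w \<Longrightarrow> min_period w \<le> j"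
  unfolding min_period_def by (simp add: Least_le)

lemma rotate_mod_min_period:
  assumes "w \<noteq> []"
  shows "rotate (j mod min_period w) w = rotate j w"
proof -
  have "rotate (m * min_period w) w = w" for m
    by (induction m) (simp_all add: min_period assms flip: rotate_rotate)
  then have "rotate (j mod min_period w) (rotate (j div min_period w * min_period w) w) =
      rotate (j mod min_period w) w" by simp
  then show ?thesis by (simp add: rotate_rotate)
qed

text \<open>The numbers \<open>j\<close> that rotate \<open>w\<close> into itself are closed under remainders.\<close>

lemma min_period_dvd:
  assumes "w \<noteq> []" "rotate j w = w"
  shows "min_period w dvd j"
proof (rule ccontr)
  assume "\<not> min_period w dvd j"
  then have "j mod min_period w > 0" by (simp add: dvd_eq_mod_eq_0)
  then have "min_period w \<le> j mod min_period w"
    using rotate_mod_min_period[OF assms(1), of j] assms(2) by (intro min_period_le) auto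
  then show False using min_period(1)[OF assms(1)] by (metis mod_less_divisor not_less)
qed

lemma word_eq_power_of_root:
  assumes "w \<noteq> []"
  shows "w = concat (replicate (length w div min_period w) (take (min_period w) w))"
proof (rule commuting_words_power)
  let ?p = "min_period w"
  have "w = take ?p w @ drop ?p w" by simp
  then have "drop ?p w @ take ?p w = w"
    by (metis min_period(2,3)[OF assms] length_take min.absorb2 rotate_append)
  then have "take ?p w @ w = take ?p w @ (drop ?p w @ take ?p w)" by simp
  also have "\<dots> = w @ take ?p w" by (simp flip: append_assoc)
  finally show "take ?p w @ w = w @ take ?p w" .
  have "?p dvd length w" using assms by (intro min_period_dvd) auto
  then show "length w = length w div ?p * length (take ?p w)"
    using min_period(3)[OF assms] by simp
qed

section \<open>Reduced forms and words\<close>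

lemma power_mult_inverse_power: "g ^ n * inverse g ^ n = (1::psl2r)"
proof (induction n)
  case (Suc n)
  have "g ^ Suc n * inverse g ^ Suc n = g * (g ^ n * inverse g ^ n) * inverse g"
    by (metis mult.assoc power_Suc power_Suc2)
  then show ?case by (simp add: Suc psl2r_right_inverse)
qed simp

text \<open>The eigenvalue at the attracting fixed point would be a number greater than \<open>1\<close> with \<open>n\<close>-th power \<open>1\<close>.\<close>

lemma finite_order_not_hyperbolic:
  assumes "g ^ n = 1" "n > 0"
  shows "g \<notin> hyperbolic"
proof
  assume "g \<in> hyperbolic"
  then obtain F where F: "psi2 F = g" using psi2_surj by auto
  have "act_p1r (g ^ m) (x_att F) = x_att F \<and> act_factor (g ^ m) (x_att F) = act_factor g (x_att F) ^ m" for m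
    using x_att_fixed(1)[of F] unfolding F
    by (induction m) (auto simp: act_p1r_mult act_factor_mult)
  from this[of n] have "act_factor g (x_att F) ^ n = 1" using assms by simp
  moreover have "act_factor g (x_att F) ^ n > 1"
    using x_att_fixed(2)[of F] assms(2) unfolding F by simp
  ultimately show False by simp
qed

context
  fixes q :: nat
  assumes q3: "q \<ge> 3"
begin

lemma hecke_U_mem: "hecke_U q \<in> hecke_group q"
  unfolding hecke_U_def by (intro hecke_group.intros)

lemma hecke_group_power: "g \<in> hecke_group q \<Longrightarrow> g ^ n \<in> hecke_group q"
  by (induction n) (auto intro: hecke_group.intros)

lemma hecke_V_mem: "hecke_V q k \<in> hecke_group q"
  unfolding hecke_V_def by (intro hecke_group.intros hecke_group_power hecke_U_mem)

lemma word_psl_mem: "word_psl q w \<in> hecke_group q"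
  by (induction w) (auto intro: hecke_group.intros hecke_V_mem)

text \<open>
  Of the four normal forms, \<open>v S\<close> makes the negative point \<open>y\<close> positive and \<open>S v\<close> makes the
  positive point \<open>x\<close> negative. The remaining ones are \<open>v\<close> and \<open>S v S\<close>, and the latter is the inverse
  of a word.
\<close>

lemma sign_preserving_word:
  assumes "h \<in> hecke_group q" "x > 0" "y < 0"
    and hx: "\<exists>x'>0. act_p1r h (Fin x) = Fin x'" and hy: "\<exists>y'<0. act_p1r h (Fin y) = Fin y'"
  shows "\<exists>v. set v \<subseteq> letters q \<and> (h = word_psl q v \<or> inverse h = word_psl q v)"
proof -
  note nn = act_nonneg_psl_pos[OF word_psl_nonneg[OF q3]]
  from hecke_groupE[OF q3 assms(1)] show ?thesis
  proof cases
    case (2 v)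
    obtain x' where "x' > 0" "act_p1r hecke_S (Fin y) = Fin x'"
      using act_hecke_S_neg assms(3) by blast
    then have "\<exists>y'>0. act_p1r h (Fin y) = Fin y'"
      using nn[OF 2(1)] by (simp add: 2(2) act_p1r_mult)
    then show ?thesis using hy by auto
  next
    case (3 v)
    obtain x' where "x' > 0" "act_p1r (word_psl q v) (Fin x) = Fin x'"
      using nn[OF 3(1)] assms(2) by blast
    then have "\<exists>y'<0. act_p1r h (Fin x) = Fin y'"
      using act_hecke_S_pos by (simp add: 3(2) act_p1r_mult)
    then show ?thesis using hx by auto
  next
    case (4 v)
    obtain v' where v': "set v' \<subseteq> letters q" "inverse (word_psl q v) = hecke_S * word_psl q v' * hecke_S"
      using inverse_word_psl[OF q3 4(1)] .
    then have "inverse h = word_psl q v'"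
      by (simp add: 4(2) psl2r_inverse_mult mult.assoc)
    then show ?thesis using v'(1) by blast
  qed auto
qed

text \<open>
  In the normal forms \<open>w S\<close>, \<open>S w\<close> and \<open>S w S\<close> one of the two fixed points has the wrong sign. The
  last two are reduced to known cases by conjugation with \<open>S\<close>.
\<close>

lemma reduced_iff_word:
  assumes "F \<in> hecke_forms q"
  shows "reduced F \<longleftrightarrow> (\<exists>w. set w \<subseteq> letters q \<and> psi2 F = word_psl q w)"
proof
  assume "\<exists>w. set w \<subseteq> letters q \<and> psi2 F = word_psl q w"
  then show "reduced F" using nonneg_hyperbolic_fixed_points(3)[of F] word_psl_nonneg[OF q3] by auto
next
  assume red: "reduced F"
  have "psi2 F \<in> hecke_group q" using assms by (simp add: hecke_forms_def hecke_hyperbolic_def)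
  from hecke_groupE[OF q3 this] show "\<exists>w. set w \<subseteq> letters q \<and> psi2 F = word_psl q w"
  proof cases
    case (2 w)
    then have "\<exists>x>0. x_rep F = Fin x"
      using fixed_point_nonneg_mult_S[OF word_psl_nonneg[OF q3 2(1)], of "x_rep F"] x_rep_fixed(1)[of F]
      by simp
    then show ?thesis using red by (auto simp: reduced_def)
  next
    case (3 w)
    have "psi2 (act_poqf hecke_S F) = word_psl q w * hecke_S"
      by (simp add: psi2_act 3(2) mult.assoc)
    then obtain x where "x > 0" "x_att (act_poqf hecke_S F) = Fin x"
      using fixed_point_nonneg_mult_S[OF word_psl_nonneg[OF q3 3(1)]] x_att_fixed(1) by metis
    moreover have "x_att F = act_p1r hecke_S (x_att (act_poqf hecke_S F))"
      by (simp add: x_att_act flip: act_p1r_mult)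
    ultimately show ?thesis using act_hecke_S_pos[of x] red by (auto simp: reduced_def)
  next
    case (4 w)
    have "psi2 (act_poqf hecke_S F) = word_psl q w"
      by (simp add: psi2_act 4(2) mult.assoc)
    then obtain x where "x > 0" "x_att (act_poqf hecke_S F) = Fin x"
      using nonneg_hyperbolic_fixed_points(1)[of "act_poqf hecke_S F"] word_psl_nonneg[OF q3 4(1)] by auto
    moreover have "x_att F = act_p1r hecke_S (x_att (act_poqf hecke_S F))"
      by (simp add: x_att_act flip: act_p1r_mult)
    ultimately show ?thesis using act_hecke_S_pos[of x] red by (auto simp: reduced_def)
  qed auto
qed

text \<open>
  The conjugating element maps fixed points to fixed points of the same kind. As both forms are reduced,
  it preserves their signs, so it is a word or the inverse of one, and the conjugacy becomes an equation
  of the type \<open>u @ v = v @ w\<close> between words.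
\<close>

lemma conjugate_reduced_words:
  assumes w: "set w \<subseteq> letters q" "psi2 G = word_psl q w"
    and u: "set u \<subseteq> letters q" "psi2 (act_poqf h G) = word_psl q u"
    and h: "h \<in> hecke_group q"
  shows "\<exists>i. u = rotate i w"
proof -
  let ?R = "act_poqf h G"
  have nn: "psi2 G \<in> nonneg_psl" "psi2 ?R \<in> nonneg_psl" using w u word_psl_nonneg[OF q3] by auto
  obtain x y where xy: "x > 0" "x_att G = Fin x" "y < 0" "x_rep G = Fin y"
    using nonneg_hyperbolic_fixed_points[OF nn(1)] by auto
  have "\<exists>x'>0. act_p1r h (Fin x) = Fin x'" "\<exists>y'<0. act_p1r h (Fin y) = Fin y'"
    using nonneg_hyperbolic_fixed_points(1,2)[OF nn(2)] xy by (simp_all add: x_att_act x_rep_act)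
  then obtain v where v: "set v \<subseteq> letters q" "h = word_psl q v \<or> inverse h = word_psl q v"
    using sign_preserving_word h xy by blast
  have eq: "word_psl q u * h = h * word_psl q w"
    using u(2) w(2) by (simp add: psi2_act mult.assoc psl2r_left_inverse flip: u(2))
  from v(2) show ?thesis
  proof
    assume "h = word_psl q v"
    then have "word_psl q (u @ v) = word_psl q (v @ w)" using eq by simp
    then have "u @ v = v @ w" using word_psl_inj[OF q3, of "u @ v" "v @ w"] u v w by simp
    then show ?thesis using conjugate_words_rotate(2) by metis
  next
    assume h: "inverse h = word_psl q v"
    have "inverse h * word_psl q u = word_psl q w * inverse h"
      by (metis eq mult.assoc mult_1_right psl2r_cancel_left(1) psl2r_right_inverse)
    then have "word_psl q (w @ v) = word_psl q (v @ u)" using h by simp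
    then have "w @ v = v @ u" using word_psl_inj[OF q3, of "w @ v" "v @ u"] u v w by simp
    then show ?thesis using conjugate_words_rotate(1) by metis
  qed
qed

section \<open>Runs of the algorithm\<close>

text \<open>
  For \<open>w = k # v @ [l]\<close>, conjugation turns \<open>w S\<close> into \<open>v V\<^sub>l S V\<^sub>k = v U\<^bsup>l+k\<^esup> S\<close>. The last factor is a
  letter, or \<open>S\<close> if \<open>l + k = q\<close>. Words with fewer than two letters give the elements \<open>S\<close> and
  \<open>U\<^sup>k\<close> of finite order.
\<close>

lemma preperiod_step:
  assumes w: "set w \<subseteq> letters q" "psi2 F = word_psl q w * hecke_S"
  obtains k w' s where "k \<in> letters q" "set w' \<subseteq> letters q" "length w' < length w" "s \<in> {1, hecke_S}"
    "psi2 (act_poqf (inverse (hecke_V q k)) F) = word_psl q w' * s"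
proof -
  have "w \<noteq> []"
    using finite_order_not_hyperbolic[of hecke_S 2] psi2_hyperbolic[of F] w
    by (auto simp: power2_eq_square)
  then obtain k u where w': "w = k # u" by (cases w) auto
  have "u \<noteq> []"
  proof
    assume "u = []"
    then have "psi2 F = hecke_U q ^ k" using w w' by (simp add: hecke_V_def mult.assoc)
    moreover have "(hecke_U q ^ k) ^ q = 1"
      by (metis hecke_U_power_q[OF q3] mult.commute power_mult power_one)
    ultimately show False
      using finite_order_not_hyperbolic[of "hecke_U q ^ k" q] psi2_hyperbolic[of F] q3 by simp
  qed
  then obtain v l where u: "u = v @ [l]" by (metis rev_exhaust)
  have letters: "k \<in> letters q" "l \<in> letters q" "set v \<subseteq> letters q" using w w' u by auto
  let ?G = "act_poqf (inverse (hecke_V q k)) F"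
  have "psi2 ?G = word_psl q v * (hecke_V q l * hecke_S * hecke_V q k)"
    by (simp add: psi2_act w w' u mult.assoc)
  then have G: "psi2 ?G = word_psl q v * (hecke_U q ^ (l + k) * hecke_S)"
    by (simp add: mult.assoc power_add hecke_V_def)
  consider "l + k < q" | "l + k = q" | "l + k > q" by linarith
  then show ?thesis
  proof cases
    case 1
    then have "l + k \<in> letters q" using letters by (auto simp: letters_def)
    then show ?thesis using that[of k "v @ [l + k]" 1] letters G by (simp add: hecke_V_def w' u)
  next
    case 2
    then show ?thesis using that[of k v hecke_S] letters G hecke_U_power_q[OF q3] by (simp add: w' u)
  next
    case 3
    then have "hecke_U q ^ (l + k) = hecke_U q ^ q * hecke_U q ^ (l + k - q)"
      by (simp flip: power_add)
    moreover have "l + k - q \<in> letters q" using letters 3 by (auto simp: letters_def)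
    ultimately show ?thesis using that[of k "v @ [l + k - q]" 1] letters G hecke_U_power_q[OF q3]
      by (simp add: hecke_V_def w' u)
  qed
qed

lemma x_att_pos:
  assumes "set w \<subseteq> letters q" "s \<in> {1, hecke_S}" "psi2 F = word_psl q w * s"
  shows "\<exists>x>0. x_att F = Fin x"
proof (cases "s = hecke_S")
  case True
  then show ?thesis using assms x_att_fixed(1)[of F]
    fixed_point_nonneg_mult_S[OF word_psl_nonneg[OF q3 assms(1)], of "x_att F"] by simp
next
  case False
  then show ?thesis using assms nonneg_hyperbolic_fixed_points(1)[of F] word_psl_nonneg[OF q3 assms(1)] by simp
qed

text \<open>
  With \<open>s = S\<close> the repelling fixed point is positive, so the loop goes on; the attracting one lies in
  the interval of the first letter, so the loop performs exactly the conjugation that shortens the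
  word. The accumulated factor \<open>t\<close> carries the final form back to the first one.
\<close>

lemma preperiod_loop_result:
  assumes "Fs \<noteq> []" "set w \<subseteq> letters q" "s \<in> {1, hecke_S}" "psi2 (last Fs) = word_psl q w * s"
  shows "\<exists>Gs G t u. preperiod_loop q Fs (x_att (last Fs)) (x_rep (last Fs)) h =
      Some (Fs @ Gs, x_att G, x_rep G, h * t) \<and> G = last (Fs @ Gs) \<and>
      t \<in> hecke_group q \<and> last Fs = act_poqf t G \<and> set u \<subseteq> letters q \<and> psi2 G = word_psl q u"
  using assms
proof (induction "length w" arbitrary: Fs w s h rule: less_induct)
  case less
  let ?F = "last Fs"
  show ?case
  proof (cases "s = 1")
    case True
    then have "psi2 ?F = word_psl q w" using less by simp
    moreover from this have "reduced ?F"
      using nonneg_hyperbolic_fixed_points(3)[of ?F] word_psl_nonneg[OF q3 less.prems(2)] by simp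
    ultimately show ?thesis
      using less.prems(2)
      by (intro exI[of _ "[]"] exI[of _ ?F] exI[of _ 1] exI[of _ w])
         (simp add: preperiod_loop.simps hecke_group.intros)
  next
    case False
    then have F: "psi2 ?F = word_psl q w * hecke_S" using less by simp
    have "\<exists>x>0. x_rep ?F = Fin x"
      using fixed_point_nonneg_mult_S[OF word_psl_nonneg[OF q3 less.prems(2)], of "x_rep ?F"]
        x_rep_fixed(1)[of ?F] F by simp
    then have nr: "\<not> reduced ?F" by (auto simp: reduced_def)
    obtain k w' s' where k: "k \<in> letters q" "set w' \<subseteq> letters q" "length w' < length w"
      "s' \<in> {1, hecke_S}" "psi2 (act_poqf (inverse (hecke_V q k)) ?F) = word_psl q w' * s'"
      using preperiod_step[OF less.prems(2) F] .
    define G where "G = act_poqf (inverse (hecke_V q k)) ?F"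
    obtain x where x: "x > 0" "x_att G = Fin x" using x_att_pos[OF k(2,4), of G] k(5) G_def by auto
    have FG: "?F = act_poqf (hecke_V q k) G"
      by (simp add: G_def psl2r_right_inverse flip: act_poqf_mult)
    have "interval q (x_att ?F) = Some (int k)"
      unfolding FG x_att_act x(2) by (rule interval_act_V[OF q3 k(1) x(1)])
    then have step: "preperiod_loop q Fs (x_att ?F) (x_rep ?F) h =
        preperiod_loop q (Fs @ [G]) (x_att G) (x_rep G) (h * hecke_V q k)"
      by (subst preperiod_loop.simps) (simp add: nr hecke_g_eq G_def x_att_act x_rep_act)
    have ne: "Fs @ [G] \<noteq> []" by simp
    have "psi2 (last (Fs @ [G])) = word_psl q w' * s'" using k(5) by (simp add: G_def)
    from less.hyps[OF k(3) ne k(2,4) this, of "h * hecke_V q k", unfolded last_snoc] obtain Gs G' t u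
      where *: "preperiod_loop q (Fs @ [G]) (x_att G) (x_rep G) (h * hecke_V q k) =
        Some ((Fs @ [G]) @ Gs, x_att G', x_rep G', h * hecke_V q k * t)" "G' = last ((Fs @ [G]) @ Gs)"
      "t \<in> hecke_group q" "G = act_poqf t G'" "set u \<subseteq> letters q" "psi2 G' = word_psl q u"
      by blast
    \<comment> \<open>The new step comes first in the accumulated product.\<close>
    have "?F = act_poqf (hecke_V q k * t) G'" using FG *(4) by (simp only: act_poqf_mult)
    moreover have "hecke_V q k * t \<in> hecke_group q" using *(3) by (intro hecke_group.intros hecke_V_mem)
    moreover have "preperiod_loop q Fs (x_att ?F) (x_rep ?F) h =
        Some (Fs @ (G # Gs), x_att G', x_rep G', h * (hecke_V q k * t))"
      unfolding step *(1) by (simp add: mult.assoc)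
    moreover have "G' = last (Fs @ (G # Gs))" using *(2) by simp
    ultimately show ?thesis using *(5,6) by blast
  qed
qed

text \<open>
  In this context \<open>G\<close> is the reduced form that ends the preperiod, and \<open>R j\<close> is the form that the
  period loop reaches from it after \<open>j\<close> steps.
\<close>

context
  fixes w :: "nat list" and G :: poqf and R :: "nat \<Rightarrow> poqf"
  assumes w: "set w \<subseteq> letters q" "psi2 G = word_psl q w"
  defines "R \<equiv> \<lambda>j. act_poqf (inverse (word_psl q (take j w))) G"
begin

lemma hyperbolic_word_not_Nil: "w \<noteq> []"
  using w finite_order_not_hyperbolic[of 1 1] psi2_hyperbolic[of G] by auto

lemma rotated_0 [simp]: "R 0 = G"
  by (simp add: R_def)

lemma rotated_Suc: "j < length w \<Longrightarrow> R (Suc j) = act_poqf (inverse (hecke_V q (w ! j))) (R j)"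
  by (simp add: R_def take_Suc_conv_app_nth psl2r_inverse_mult flip: act_poqf_mult)

lemma psi2_rotated:
  assumes "j \<le> length w"
  shows "psi2 (R j) = word_psl q (rotate j w)"
proof -
  have "rotate j w = drop j w @ take j w"
    using rotate_append[of "take j w" "drop j w"] assms by (simp add: min_absorb2)
  moreover have "word_psl q w = word_psl q (take j w) * word_psl q (drop j w)"
    by (metis append_take_drop_id word_psl_simps(3))
  ultimately show ?thesis by (simp add: R_def psi2_act w mult.assoc)
qed

lemma x_att_rotated: "j \<le> length w \<Longrightarrow> \<exists>x>0. x_att (R j) = Fin x"
  using x_att_pos[of "rotate j w" 1 "R j"] psi2_rotated w by simp

text \<open>
  The words in question have the same length, so the attracting fixed point alone identifies them. This is
  why a comparison of fixed points is a correct exit test for a loop over forms.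
\<close>

lemma rotated_eq_iff:
  assumes "i \<le> length w" "j \<le> length w"
  shows "x_att (R i) = x_att (R j) \<longleftrightarrow> rotate i w = rotate j w"
    and "R i = R j \<longleftrightarrow> rotate i w = rotate j w"
proof -
  obtain x where x: "x > 0" "x_att (R i) = Fin x" using x_att_rotated assms by blast
  have "rotate i w = rotate j w" if "x_att (R i) = x_att (R j)"
    using word_psl_prefix_unique[OF q3, of "rotate i w" "rotate j w" x x] that x
      x_att_fixed(1)[of "R i"] x_att_fixed(1)[of "R j"] psi2_rotated assms w by simp
  moreover have "R i = R j" if "rotate i w = rotate j w"
    using psi2_rotated[OF assms(1)] psi2_rotated[OF assms(2)] that by (metis psi2_inject)
  ultimately show "x_att (R i) = x_att (R j) \<longleftrightarrow> rotate i w = rotate j w"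
    "R i = R j \<longleftrightarrow> rotate i w = rotate j w" by auto
qed

lemma period_loop_result_from:
  assumes "j < min_period w"
  shows "period_loop q (phi2 G) (map R [1..<Suc j]) (R j) (x_att (R j)) (x_rep (R j)) (word_psl q (take j w)) =
    Some (map R [1..<Suc (min_period w)], word_psl q (take (min_period w) w))"
  using assms
proof (induction "min_period w - j" arbitrary: j rule: less_induct)
  case less
  have j: "j < length w" using less.prems min_period(3)[OF hyperbolic_word_not_Nil] by simp
  then obtain x where x: "x > 0" "x_att (R (Suc j)) = Fin x" using x_att_rotated[of "Suc j"] by auto
  have Rj: "R j = act_poqf (hecke_V q (w ! j)) (R (Suc j))"
    using j by (simp add: rotated_Suc psl2r_right_inverse flip: act_poqf_mult)
  have "w ! j \<in> letters q" using j w by auto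
  then have int: "interval q (x_att (R j)) = Some (int (w ! j))"
    unfolding Rj x_att_act x(2) using interval_act_V[OF q3] x(1) by blast
  have "phi2 (R (Suc j)) = phi2 G \<longleftrightarrow> R (Suc j) = R 0"
    using rotated_eq_iff[of "Suc j" 0] j unfolding phi2_def rotated_0 by auto
  also have "\<dots> \<longleftrightarrow> Suc j = min_period w"
  proof -
    have "R (Suc j) = R 0 \<longleftrightarrow> rotate (Suc j) w = w"
      using rotated_eq_iff(2)[of "Suc j" 0] j by simp
    also have "\<dots> \<longleftrightarrow> Suc j = min_period w"
      using min_period_le[of "Suc j" w] min_period(2)[OF hyperbolic_word_not_Nil] less.prems by (metis Suc_leI le_antisym zero_less_Suc)
    finally show ?thesis .
  qed
  finally have exit: "(x_att (R (Suc j)), x_rep (R (Suc j))) = phi2 G \<longleftrightarrow> Suc j = min_period w"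
    by (simp add: phi2_def)
  have step: "period_loop q (phi2 G) (map R [1..<Suc j]) (R j) (x_att (R j)) (x_rep (R j)) (word_psl q (take j w)) =
    (if Suc j = min_period w then Some (map R [1..<Suc (Suc j)], word_psl q (take (Suc j) w))
     else period_loop q (phi2 G) (map R [1..<Suc (Suc j)]) (R (Suc j)) (x_att (R (Suc j)))
       (x_rep (R (Suc j))) (word_psl q (take (Suc j) w)))"
    by (subst period_loop.simps)
       (simp add: int hecke_g_eq Let_def take_Suc_conv_app_nth j
         flip: x_att_act x_rep_act rotated_Suc exit)
  show ?case
  proof (cases "Suc j = min_period w")
    case False
    then have "Suc j < min_period w" using less.prems by simp
    then show ?thesis unfolding step if_not_P[OF False] by (intro less.hyps) auto
  qed (unfold step, simp)
qed

lemma period_loop_result: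
  "period_loop q (x_att G, x_rep G) [] G (x_att G) (x_rep G) 1 =
    Some (map R [1..<Suc (min_period w)], word_psl q (take (min_period w) w))"
  using period_loop_result_from[of 0] min_period(1)[OF hyperbolic_word_not_Nil] by (simp add: phi2_def)

lemma distinct_period: "distinct (map R [1..<Suc (min_period w)])"
proof -
  have neq: "R i \<noteq> R j" if "1 \<le> i" "i < j" "j \<le> min_period w" for i j
  proof
    assume "R i = R j"
    then have "rotate i w = rotate i (rotate (j - i) w)"
      using rotated_eq_iff(2)[of i j] that min_period(3)[OF hyperbolic_word_not_Nil] by (simp add: rotate_rotate)
    then have "rotate (j - i) w = w" using inj_rotate by (metis injD)
    then show False using min_period_le[of "j - i" w] that by simp
  qed
  have "inj_on R {1..<Suc (min_period w)}"
  proof (rule inj_onI)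
    fix i j assume "i \<in> {1..<Suc (min_period w)}" "j \<in> {1..<Suc (min_period w)}" "R i = R j"
    then show "i = j" using neq[of i j] neq[of j i] by (cases i j rule: linorder_cases) auto
  qed
  then show ?thesis by (simp only: distinct_map distinct_upt set_upt)
qed

lemma last_period: "last (map R [1..<Suc (min_period w)]) = G"
proof -
  have "R (min_period w) = R 0"
    using rotated_eq_iff(2)[of "min_period w" 0] min_period[OF hyperbolic_word_not_Nil] by simp
  then show ?thesis using min_period(1)[OF hyperbolic_word_not_Nil] by (simp add: last_map)
qed

text \<open>
  Reduced forms in the orbit of \<open>G\<close> belong to rotations of \<open>w\<close>, and these depend only on the
  residue modulo the least period. As the list starts at index \<open>1\<close>, residue \<open>0\<close> is represented by
  the period itself.
\<close>

lemma set_period: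
  "set (map R [1..<Suc (min_period w)]) = {F \<in> hecke_forms q. reduced F \<and> hecke_equiv q G F}"
proof (intro equalityI subsetI)
  fix F assume "F \<in> set (map R [1..<Suc (min_period w)])"
  then obtain j where j: "F = R j" "j \<le> length w"
    using min_period(3)[OF hyperbolic_word_not_Nil] by auto
  have "psi2 F = word_psl q (rotate j w)" using psi2_rotated j by simp
  then have F: "F \<in> hecke_forms q"
    using word_psl_mem psi2_hyperbolic[of F] by (simp add: hecke_forms_def hecke_hyperbolic_def)
  moreover have "reduced F" using reduced_iff_word[OF F] \<open>psi2 F = _\<close> w
    by (metis set_rotate)
  moreover have "hecke_equiv q G F" unfolding hecke_equiv_def j R_def
    by (rule bexI[where x = "inverse (word_psl q (take j w))"])
       (simp_all add: hecke_group.intros word_psl_mem)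
  ultimately show "F \<in> {F \<in> hecke_forms q. reduced F \<and> hecke_equiv q G F}" by simp
next
  fix F assume "F \<in> {F \<in> hecke_forms q. reduced F \<and> hecke_equiv q G F}"
  then obtain u h where u: "set u \<subseteq> letters q" "psi2 F = word_psl q u" "h \<in> hecke_group q"
    "F = act_poqf h G" using reduced_iff_word unfolding hecke_equiv_def by auto
  then obtain i where i: "u = rotate i w" using conjugate_reduced_words[OF w] by blast
  let ?p = "min_period w"
  define j where "j = (if i mod ?p = 0 then ?p else i mod ?p)"
  have p: "?p > 0" using min_period(1)[OF hyperbolic_word_not_Nil] .
  have "rotate j w = u" unfolding i using rotate_mod_min_period[OF hyperbolic_word_not_Nil, of i]
    min_period(2)[OF hyperbolic_word_not_Nil] by (auto simp: j_def)
  moreover have j: "1 \<le> j" "j \<le> ?p" using p mod_less_divisor[of ?p i]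
    by (auto simp: j_def less_imp_le simp del: mod_less_divisor)
  ultimately have "psi2 F = psi2 (R j)" using u psi2_rotated[of j] min_period(3)[OF hyperbolic_word_not_Nil] by simp
  then have "F = R j" by simp
  then show "F \<in> set (map R [1..<Suc ?p])" unfolding set_map set_upt using j by (intro image_eqI) auto
qed

text \<open>
  A root \<open>h\<close> of \<open>\<psi>\<^sub>2(G)\<close> commutes with it, so it fixes the form \<open>G\<close> and both its zeros. Hence \<open>h\<close> is a
  word \<open>v\<close> or the inverse of one. In the first case \<open>w\<close> is the \<open>n\<close>-fold repetition of \<open>v\<close>, and rotation
  by \<open>length v\<close> fixes \<open>w\<close>. In the second case a nonempty word would represent the identity.
\<close>

lemma level_le:
  assumes "h \<in> hecke_group q" "psi2 G = h ^ n"
  shows "n \<le> length w div min_period w"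
proof (cases "n = 0")
  case False
  have "psi2 (act_poqf h G) = psi2 G"
    by (simp add: psi2_act assms(2) mult.assoc psl2r_right_inverse power_commutes flip: power_Suc2)
       (metis mult.assoc mult_1_right power_commutes psl2r_right_inverse)
  then have hG: "act_poqf h G = G" by simp
  have "psi2 G \<in> nonneg_psl" using w word_psl_nonneg[OF q3] by simp
  then obtain x y where xy: "x > 0" "x_att G = Fin x" "y < 0" "x_rep G = Fin y"
    using nonneg_hyperbolic_fixed_points by metis
  have "act_p1r h (Fin x) = Fin x" "act_p1r h (Fin y) = Fin y"
    using x_att_act[of h G] x_rep_act[of h G] xy hG by simp_all
  then obtain v where v: "set v \<subseteq> letters q" "h = word_psl q v \<or> inverse h = word_psl q v"
    using sign_preserving_word assms(1) xy by metis
  define vn where "vn = concat (replicate n v)"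
  have vn: "set vn \<subseteq> letters q" "word_psl q vn = word_psl q v ^ n"
    using v by (auto simp: vn_def word_psl_power)
  from v(2) show ?thesis
  proof
    assume "h = word_psl q v"
    then have wvn: "w = vn" using word_psl_inj[OF q3 w(1) vn(1)] assms(2) w vn by simp
    obtain m where m: "n = Suc m" using False not0_implies_Suc by blast
    have "rotate (length v) w = w"
      unfolding wvn vn_def m by (simp add: rotate_append concat_replicate_append)
    moreover have "length w = n * length v" unfolding wvn vn_def by (induction n) simp_all
    moreover from this have "length v > 0" using hyperbolic_word_not_Nil by auto
    ultimately have "n * min_period w \<le> length w" using min_period_le[of "length v" w] by simp
    then show ?thesis using min_period(1)[OF hyperbolic_word_not_Nil] by (simp add: less_eq_div_iff_mult_less_eq)
  next
    assume "inverse h = word_psl q v"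
    then have "word_psl q (w @ vn) = 1"
      using power_mult_inverse_power[of h n] assms(2) w vn by simp
    then show ?thesis using word_psl_eq_1_iff[OF q3, of "w @ vn"] w vn hyperbolic_word_not_Nil by simp
  qed
qed simp

text \<open>
  The positive powers of the root are hyperbolic, so \<open>psi2_inv\<close> is defined on all conjugates that the loop
  meets. They are pairwise different because the words have different lengths, so the loop stops exactly at
  the exponent that gives \<open>w\<close>.
\<close>

lemma level_loop_result:
  assumes F: "F = act_poqf h G" and n: "1 \<le> n" "n \<le> length w div min_period w"
  shows "level_loop F h (word_psl q (take (min_period w) w)) n = Some (length w div min_period w)"
  using n
proof (induction "length w div min_period w - n" arbitrary: n rule: less_induct)
  case less
  let ?u = "take (min_period w) w"
  let ?a = "word_psl q ?u"
  let ?n0 = "length w div min_period w"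
  have a0: "psi2 G = ?a ^ ?n0"
    using word_eq_power_of_root[OF hyperbolic_word_not_Nil] w by (metis word_psl_power)
  have u: "set ?u \<subseteq> letters q" using w by (auto dest: in_set_takeD)
  have nn: "?a \<in> nonneg_psl" using word_psl_nonneg[OF q3 u] .
  have hyp: "?a \<in> hyperbolic" using nonneg_psl_hyperbolic_root[OF nn] a0 psi2_hyperbolic[of G] by metis
  have "?a ^ n = ?a * ?a ^ (n - 1)" using less.prems by (metis One_nat_def Suc_le_lessD Suc_pred power_Suc)
  then have "?a ^ n \<in> hyperbolic"
    using nonneg_psl_hyperbolic_mult[OF nn hyp nonneg_psl_power[OF nn]] by simp
  then obtain H where H: "psi2 H = ?a ^ n" using psi2_surj by blast
  have inv: "psi2_inv (h * ?a ^ n * inverse h) = Some (act_poqf h H)"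
    by (simp add: psi2_inv_iff psi2_act H)
  have "act_poqf h H = F \<longleftrightarrow> ?a ^ n = ?a ^ ?n0"
    unfolding F using H a0 psi2_inject[of "act_poqf h H" "act_poqf h G"]
    by (simp add: psi2_act mult.assoc del: psi2_inject)
  also have "\<dots> \<longleftrightarrow> n = ?n0"
  proof
    assume "?a ^ n = ?a ^ ?n0"
    then have "concat (replicate n ?u) = concat (replicate ?n0 ?u)"
      using word_psl_inj[OF q3, of "concat (replicate n ?u)" "concat (replicate ?n0 ?u)"] u
      by (simp add: word_psl_power set_replicate_conv_if)
    moreover have "length (concat (replicate m ?u)) = m * min_period w" for m
      using min_period(3)[OF hyperbolic_word_not_Nil] by (induction m) simp_all
    ultimately show "n = ?n0" using min_period(1)[OF hyperbolic_word_not_Nil] by (metis mult_right_cancel not_gr_zero)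
  qed simp
  finally have exit: "act_poqf h H = F \<longleftrightarrow> n = ?n0" .
  show ?case
  proof (cases "n = ?n0")
    case True
    then show ?thesis by (subst level_loop.simps, subst inv) (simp add: exit)
  next
    case False
    with less.prems have "n < ?n0" by simp
    moreover from this have "level_loop F h ?a (Suc n) = Some ?n0" by (intro less.hyps) auto
    ultimately show ?thesis by (subst level_loop.simps, subst inv) (simp add: exit)
  qed
qed

end

end

text \<open>
  The initial application of \<open>S\<close> is governed by the sign of the attracting zero, and this zero is
  negative if and only if the normal form of \<open>\<psi>\<^sub>2(F)\<close> begins with \<open>S\<close>.
\<close>

lemma preperiod_result:
  assumes q3: "q \<ge> 3" and F: "F \<in> hecke_forms q"
  obtains Fs G h u where
    "(if x_att F < Fin 0
      then preperiod_loop q [F, act_poqf hecke_S F] (act_p1r hecke_S (x_att F))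
        (act_p1r hecke_S (x_rep F)) hecke_S
      else preperiod_loop q [F] (x_att F) (x_rep F) 1) = Some (Fs, x_att G, x_rep G, h)"
    "Fs \<noteq> []" "hd Fs = F" "last Fs = G" "h \<in> hecke_group q" "F = act_poqf h G"
    "set u \<subseteq> letters q" "psi2 G = word_psl q u"
proof -
  have "psi2 F \<in> hecke_group q" using F by (simp add: hecke_forms_def hecke_hyperbolic_def)
  then have "psi2 F \<in> S_words q" by (rule hecke_group_S_words[OF q3])
  then obtain e s w
    where w: "e \<in> {1, hecke_S}" "s \<in> {1, hecke_S}" "set w \<subseteq> letters q" "psi2 F = e * word_psl q w * s"
    by (rule S_wordsE[OF q3])
  then consider "e = 1" | "e = hecke_S" by blast
  then show ?thesis
  proof cases
    case 1
    then have F: "psi2 F = word_psl q w * s" using w(4) by simp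
    obtain x where x: "x > 0" "x_att F = Fin x" using x_att_pos[OF q3 w(3,2) F] by blast
    have "[F] \<noteq> []" "psi2 (last [F]) = word_psl q w * s" using F by simp_all
    from preperiod_loop_result[OF q3 this(1) w(3,2) this(2), of 1] obtain Gs G t u where *:
      "preperiod_loop q [F] (x_att (last [F])) (x_rep (last [F])) 1 =
        Some ([F] @ Gs, x_att G, x_rep G, 1 * t)" "G = last ([F] @ Gs)"
      "t \<in> hecke_group q" "last [F] = act_poqf t G" "set u \<subseteq> letters q" "psi2 G = word_psl q u"
      by blast
    show ?thesis
      by (rule that[of "[F] @ Gs" G t u]) (use * x in simp_all)
  next
    case 2
    define F' where "F' = act_poqf hecke_S F"
    have F': "psi2 F' = word_psl q w * (s * hecke_S)"
      using w(4) 2 by (simp add: F'_def psi2_act mult.assoc)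
    have s: "s * hecke_S \<in> {1, hecke_S}" using w(2) by auto
    obtain x where x: "x > 0" "x_att F' = Fin x" using x_att_pos[OF q3 w(3) s F'] by blast
    have FF': "F = act_poqf hecke_S F'" by (simp add: F'_def flip: act_poqf_mult)
    then have neg: "x_att F < Fin 0" using x act_hecke_S_pos[of x] by (auto simp: x_att_act)
    have "[F, F'] \<noteq> []" "psi2 (last [F, F']) = word_psl q w * (s * hecke_S)" using F' by simp_all
    from preperiod_loop_result[OF q3 this(1) w(3) s this(2), of hecke_S] obtain Gs G t u where *:
      "preperiod_loop q [F, F'] (x_att (last [F, F'])) (x_rep (last [F, F'])) hecke_S =
        Some ([F, F'] @ Gs, x_att G, x_rep G, hecke_S * t)" "G = last ([F, F'] @ Gs)"
      "t \<in> hecke_group q" "last [F, F'] = act_poqf t G" "set u \<subseteq> letters q" "psi2 G = word_psl q u"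
      by blast
    show ?thesis
    proof (rule that[of "[F, F'] @ Gs" G "hecke_S * t" u])
      show "(if x_att F < Fin 0
        then preperiod_loop q [F, act_poqf hecke_S F] (act_p1r hecke_S (x_att F))
          (act_p1r hecke_S (x_rep F)) hecke_S
        else preperiod_loop q [F] (x_att F) (x_rep F) 1) =
          Some ([F, F'] @ Gs, x_att G, x_rep G, hecke_S * t)"
        using *(1) neg by (simp add: F'_def x_att_act x_rep_act)
      show "F = act_poqf (hecke_S * t) G" using FF' *(4) by (simp add: act_poqf_mult)
    qed (use * in \<open>simp_all add: hecke_group.intros\<close>)
  qed
qed

theorem theorem5p9:
  fixes q :: nat and F :: poqf
  assumes "q \<ge> 3"
    and "F \<in> hecke_forms q"
  shows "\<exists>n preperiod period g.
    reduction_algorithm q F = Some (n, preperiod, period, g) \<and>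
    preperiod \<noteq> [] \<and> hd preperiod = F \<and>
    last preperiod \<in> hecke_forms q \<and> reduced (last preperiod) \<and>
    hecke_equiv q F (last preperiod) \<and>
    period \<noteq> [] \<and> last period = last preperiod \<and> distinct period \<and>
    set period = {R \<in> hecke_forms q. reduced R \<and> hecke_equiv q F R} \<and>
    has_level q (psi2 F) n \<and>
    g = psi2 F"
proof -
  note q3 = assms(1)
  obtain Fs G h w where pre:
    "(if x_att F < Fin 0
      then preperiod_loop q [F, act_poqf hecke_S F] (act_p1r hecke_S (x_att F))
        (act_p1r hecke_S (x_rep F)) hecke_S
      else preperiod_loop q [F] (x_att F) (x_rep F) 1) = Some (Fs, x_att G, x_rep G, h)"
    and Fs: "Fs \<noteq> []" "hd Fs = F" "last Fs = G"
    and h: "h \<in> hecke_group q" "F = act_poqf h G"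
    and w: "set w \<subseteq> letters q" "psi2 G = word_psl q w"
    using preperiod_result[OF assms] .
  define n where "n = length w div min_period w"
  define a where "a = word_psl q (take (min_period w) w)"
  define Ps where "Ps = map (\<lambda>j. act_poqf (inverse (word_psl q (take j w))) G) [1..<Suc (min_period w)]"
  note w_ne = hyperbolic_word_not_Nil[OF q3 w]
  have a: "psi2 G = a ^ n"
    unfolding a_def n_def using word_eq_power_of_root[OF w_ne] w by (metis word_psl_power)
  have psi2F: "psi2 F = h * a ^ n * inverse h" by (simp add: h(2) psi2_act a)
  have "n \<ge> 1"
    unfolding n_def using min_period[OF w_ne] by (simp add: Suc_le_eq div_greater_zero_iff)
  then have level: "level_loop F h a 1 = Some n"
    unfolding a_def n_def by (intro level_loop_result[OF q3 w h(2)]) auto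
  have period: "period_loop q (x_att G, x_rep G) [] G (x_att G) (x_rep G) 1 = Some (Ps, a)"
    unfolding Ps_def a_def by (rule period_loop_result[OF q3 w])
  have run: "reduction_algorithm q F = Some (n, Fs, Ps, psi2 F)"
    unfolding reduction_algorithm_def phi2_def Let_def prod.case pre
    by (simp add: Fs(3) period level psi2F del: One_nat_def)
  have G_form: "G \<in> hecke_forms q"
    using w(2) word_psl_mem[OF q3] psi2_hyperbolic[of G] by (simp add: hecke_forms_def hecke_hyperbolic_def)
  have GF: "G = act_poqf (inverse h) F"
    using h(2) by (simp add: psl2r_left_inverse flip: act_poqf_mult)
  have equiv: "hecke_equiv q G R \<longleftrightarrow> hecke_equiv q F R" for R
  proof
    assume "hecke_equiv q G R"
    then obtain g where "g \<in> hecke_group q" "R = act_poqf g G" by (auto simp: hecke_equiv_def)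
    then have "g * inverse h \<in> hecke_group q" "R = act_poqf (g * inverse h) F"
      using GF h(1) by (simp_all add: act_poqf_mult hecke_group.intros)
    then show "hecke_equiv q F R" unfolding hecke_equiv_def by blast
  next
    assume "hecke_equiv q F R"
    then obtain g where "g \<in> hecke_group q" "R = act_poqf g F" by (auto simp: hecke_equiv_def)
    then have "g * h \<in> hecke_group q" "R = act_poqf (g * h) G"
      using h by (simp_all add: act_poqf_mult hecke_group.intros)
    then show "hecke_equiv q G R" unfolding hecke_equiv_def by blast
  qed
  have "reduced G" using reduced_iff_word[OF q3 G_form] w by blast
  moreover have "hecke_equiv q F G" unfolding hecke_equiv_def using hecke_group.intros(4)[OF h(1)] GF by blast
  moreover have "Ps \<noteq> []" unfolding Ps_def using min_period(1)[OF w_ne] by simp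
  moreover have "last Ps = G" "distinct Ps"
    unfolding Ps_def by (rule last_period[OF q3 w], rule distinct_period[OF q3 w])
  moreover have "set Ps = {R \<in> hecke_forms q. reduced R \<and> hecke_equiv q F R}"
    using set_period[OF q3 w] unfolding Ps_def equiv .
  moreover have "has_level q (psi2 F) n"
    unfolding has_level_def
  proof (intro conjI allI impI)
    show "\<exists>k\<in>hecke_group q. psi2 F = k ^ n"
    proof
      show "h * a * inverse h \<in> hecke_group q"
        unfolding a_def using h(1) by (simp add: hecke_group.intros word_psl_mem[OF q3])
      show "psi2 F = (h * a * inverse h) ^ n" by (simp add: psi2F psl2r_conj_power)
    qed
    fix m assume "\<exists>k\<in>hecke_group q. psi2 F = k ^ m"
    then obtain k where k: "k \<in> hecke_group q" "psi2 F = k ^ m" by blast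
    have "psi2 G = (inverse h * k * h) ^ m"
      using psl2r_conj_power[of "inverse h" k m] k(2) by (simp add: GF psi2_act)
    moreover have "inverse h * k * h \<in> hecke_group q" using h(1) k(1) by (simp add: hecke_group.intros)
    ultimately show "m \<le> n" unfolding n_def by (intro level_le[OF q3 w])
  qed
  ultimately show ?thesis
    by (intro exI[of _ n] exI[of _ Fs] exI[of _ Ps] exI[of _ "psi2 F"]) (simp add: run Fs G_form)
qed

end
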